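(* Let $M$ be a loopless matroid of rank $d+1$ on a finite ground set $V$, and let $V_1,\dots,V_m$ be a partition of $V$. If for every $\emptyset\ne I\subset\{1,2,\dots,m\}$ $$\varphi_M\Big(\bigcup_{i\in I}V_i\Big)>\begin{cases}|I|-1 & \text{if } |I|\le d+1,\\[2pt] d\sum_{r=1}^d r\binom{|I|-1}{r} & \text{if } |I|\ge d+2,\end{cases}$$ then $V$ contains a colorful subset in general position with respect to $M$, i.e. a set $\sigma\subset V$ in general position with $|\sigma\cap V_i|=1$ for all $i\in\{1,\dots,m\}$.
   Context: Let $\rho$ be the rank function of $M$, so $\rho(V)=d+1$. For $S\subset V$, $\operatorname{cl}(S)=\{v\in V:\rho(S\cup\{v\})=\rho(S)\}$; a flat is a set $F$ with $F=\operatorname{cl}(F)$. A subset $S\subset V$ is in general position with respect to $M$ if for every $1\le k\le d$ every flat of $M$ of rank $k$ contains at most $k$ points of $S$; equivalently (as $M$ is loopless), every $S'\subset S$ with $|S'|\le d+1$ is independent in $M$. For $S\subset V$, $\varphi_M(S)$ denotes the maximal size of a subset of $S$ in general position. *)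

theory Defs
  imports Main "HOL-Library.Disjoint_Sets"
begin

locale matroid =
  fixes V :: "'a set" and indep :: "'a set \<Rightarrow> bool"
  assumes finite_ground: "finite V"
    and indep_subset_ground: "indep X \<Longrightarrow> X \<subseteq> V"
    and indep_empty: "indep {}"
    and indep_subset: "indep X \<Longrightarrow> Y \<subseteq> X \<Longrightarrow> indep Y"
    and augment: "indep X \<Longrightarrow> indep Y \<Longrightarrow> card Y < card X \<Longrightarrow> \<exists>x \<in> X - Y. indep (insert x Y)"
begin

definition loopless :: bool where
  "loopless \<longleftrightarrow> (\<forall>v \<in> V. indep {v})"

definition rank :: "'a set \<Rightarrow> nat" where
  "rank S = Max {card X | X. X \<subseteq> S \<and> indep X}"

definition cl :: "'a set \<Rightarrow> 'a set" where
  "cl S = {v \<in> V. rank (S \<union> {v}) = rank S}"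

definition flat :: "'a set \<Rightarrow> bool" where
  "flat F \<longleftrightarrow> F \<subseteq> V \<and> F = cl F"

text \<open>For a matroid of rank \<open>d + 1\<close> the range of \<open>k\<close> below is \<open>1 \<le> k \<le> d\<close>.\<close>

definition general_position :: "'a set \<Rightarrow> bool" where
  "general_position S \<longleftrightarrow> S \<subseteq> V \<and>
     (\<forall>k F. 1 \<le> k \<and> k < rank V \<and> flat F \<and> rank F = k \<longrightarrow> card (F \<inter> S) \<le> k)"

definition phi :: "'a set \<Rightarrow> nat" where
  "phi S = Max {card X | X. X \<subseteq> S \<and> general_position X}"

end

end

theory Submission
  imports Defs "HOL-Library.Z2"
begin

text \<open>
  The sets in general position form a simplicial complex, and a colourful set in general position
  is a simplex with one vertex of each colour. By the topological form of Hall's theorem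
  (\<open>rainbow_simplex\<close>) such a simplex exists as soon as, for every nonempty \<open>I\<close>, the part of the
  complex that lives on the colours in \<open>I\<close> has vanishing reduced homology up to dimension
  \<open>|I| - 2\<close>. Homology is taken over the field with two elements. The remaining task is to bound the
  connectivity of the complex on \<open>U\<close> from below in terms of \<open>phi U\<close> (\<open>connected_upto_of_phi\<close>).

  Connectivity is bounded by two elimination rules. A vertex may be deleted, or replaced by its
  link at the price of one dimension (\<open>connected_upto_vertex\<close>). A missing face \<open>e\<close> may be filled in,
  or replaced by its link at the price of \<open>|e| - 1\<close> dimensions (\<open>connected_upto_missing_face\<close>). A
  cone is connected in every dimension, so eliminations can stop once some point is free to be
  added to every simplex.

  If \<open>|I| \<le> d + 1\<close>, the hypothesis yields an independent set of size \<open>|I|\<close> in \<open>U\<close>. In this range of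
  sizes general position is independence, and the vertex rule together with the exchange property
  gives the connectivity of the independence complex of a matroid
  (\<open>connected_upto_extensions_indep\<close>).

  If \<open>|I| \<ge> d + 2\<close>, put \<open>n = |I| - 1\<close> and take a large set \<open>S \<subseteq> U\<close> in general position. First every
  point outside \<open>S\<close> is eliminated by the vertex rule; let \<open>F\<close> be the set of those that were replaced by
  their links. What is left is the complex of all \<open>\<sigma> \<subseteq> S\<close> with \<open>\<sigma> \<union> F\<close> in general position. Its
  minimal nonfaces are traces on \<open>S\<close> of circuits that meet \<open>F\<close>, so they have at most \<open>d\<close> points; and
  since \<open>S\<close> is in general position, for \<open>D \<subseteq> S\<close> and \<open>A \<subseteq> F\<close> with \<open>|D| + |A| \<le> d\<close> at most \<open>|A|\<close> points of \<open>S\<close> complete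
  \<open>D \<union> A\<close> to a circuit (\<open>card_completions_le\<close>).

  Then the missing faces are eliminated, the largest ones first (\<open>connected_upto_avoiding\<close>). At the
  end a point \<open>x\<close> of \<open>S\<close> is a cone point unless it completes some \<open>D \<union> A\<close>, where \<open>D\<close> is made up of
  proper subsets of the contracted faces. A contracted face of size \<open>q\<close> costs \<open>q - 1\<close> and offers
  \<open>q choose i\<close> subsets of size \<open>i\<close>, which is \<open>q / (q - i)\<close> times \<open>(q - 1) choose i\<close>. Because sizes
  decrease along the process, the product of these ratios telescopes to at most \<open>|D| + 1 \<le> d\<close>
  (\<open>absorb_ratio\<close>, \<open>contracted_budget\<close>). This is the origin of the factor \<open>d\<close> in the bound; up to that
  factor, the choices of \<open>D\<close> and \<open>A\<close> with \<open>|D| + |A| = r\<close> are counted by \<open>n choose r\<close>, by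
  Vandermonde's identity (\<open>blocked_budget\<close>).
\<close>

section \<open>Chains modulo two and connectivity\<close>

(* Bits serve as the field with two elements; rewriting + and * to bit operations would hide
   the ring laws. *)
declare add_bit_eq_xor [simp del] mult_bit_eq_and [simp del]

definition complex_on :: "'a set \<Rightarrow> 'a set set \<Rightarrow> bool" where
  "complex_on V K \<longleftrightarrow> K \<subseteq> Pow V \<and> (\<forall>\<sigma>\<in>K. \<forall>\<tau>\<subseteq>\<sigma>. \<tau> \<in> K)"

lemma complex_on_finite: "finite V \<Longrightarrow> complex_on V K \<Longrightarrow> \<sigma> \<in> K \<Longrightarrow> finite \<sigma>"
  by (auto simp: complex_on_def intro: rev_finite_subset)

lemma complex_on_subset: "complex_on V K \<Longrightarrow> \<sigma> \<in> K \<Longrightarrow> \<tau> \<subseteq> \<sigma> \<Longrightarrow> \<tau> \<in> K"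
  by (auto simp: complex_on_def)

text \<open>
  A chain is a function on sets of vertices with values in the field with two elements. Working with
  functions instead of sets of simplices lets boundaries be ordinary finite sums. The sum runs over the
  vertices that can be added to \<open>\<tau>\<close>; the finite ground set \<open>V\<close> keeps it finite.
\<close>

definition boundary :: "'a set \<Rightarrow> ('a set \<Rightarrow> bit) \<Rightarrow> 'a set \<Rightarrow> bit" where
  "boundary V c \<tau> = (\<Sum>x\<in>V - \<tau>. c (insert x \<tau>))"

definition chain :: "nat \<Rightarrow> 'a set set \<Rightarrow> ('a set \<Rightarrow> bit) \<Rightarrow> bool" where
  "chain s K c \<longleftrightarrow> (\<forall>\<sigma>. c \<sigma> \<noteq> 0 \<longrightarrow> \<sigma> \<in> K \<and> card \<sigma> = s)"

text \<open>
  Vanishing of reduced homology in all dimensions up to \<open>k - 2\<close>. The index \<open>s\<close> counts vertices, so a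
  cycle of \<open>s\<close>-sets has dimension \<open>s - 1\<close>, and \<open>s = 0\<close> expresses that a complex containing the empty
  set has a vertex. The void complex has every connectivity: the link of a nonface is void, and the
  elimination rules then need no exception for it.
\<close>

definition connected_upto :: "'a set \<Rightarrow> nat \<Rightarrow> 'a set set \<Rightarrow> bool" where
  "connected_upto V k K \<longleftrightarrow>
     (\<forall>s z. s < k \<and> chain s K z \<and> (\<forall>\<tau>. boundary V z \<tau> = 0) \<longrightarrow>
        (\<exists>w. chain (Suc s) K w \<and> boundary V w = z))"

lemma connected_uptoD:
  assumes "connected_upto V k K" "s < k" "chain s K z" "\<And>\<tau>. boundary V z \<tau> = 0"
  shows "\<exists>w. chain (Suc s) K w \<and> boundary V w = z"
  using assms by (simp add: connected_upto_def)

lemma connected_upto_0 [simp]: "connected_upto V 0 K"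
  by (simp add: connected_upto_def)

lemma connected_upto_empty [simp]: "connected_upto V k {}"
proof -
  have "\<exists>w. chain (Suc s) {} w \<and> boundary V w = z" if "chain s {} z" for s z
  proof (intro exI conjI)
    show "chain (Suc s) {} (\<lambda>_. 0)" by (simp add: chain_def)
    show "boundary V (\<lambda>_. 0) = z" using that by (auto simp: chain_def boundary_def)
  qed
  then show ?thesis by (simp add: connected_upto_def)
qed

lemma chain_add:
  assumes "chain s K a" "chain s K b"
  shows "chain s K (\<lambda>\<sigma>. a \<sigma> + b \<sigma>)"
  using assms unfolding chain_def by (metis add.right_neutral)

lemma bit_double [simp]: "(x::bit) + x = 0"
  by (cases x) auto

lemma bit_add_cancel [simp]: "(x::bit) + y + y = x" "(x::bit) + (x + y) = y"
  by (simp_all add: add.assoc flip: add.assoc[of x x])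

text \<open>
  In characteristic two the terms for \<open>(x, y)\<close> and \<open>(y, x)\<close> cancel. This is the reason both for
  \<open>\<partial>\<partial> = 0\<close> and for the fact that the chains to be filled in Hall's theorem are cycles.
\<close>

lemma sum_off_diagonal_symmetric:
  fixes f :: "'a \<Rightarrow> 'a \<Rightarrow> bit"
  assumes "finite A" and "\<And>x y. f x y = f y x"
  shows "(\<Sum>x\<in>A. \<Sum>y\<in>A - {x}. f x y) = 0"
  using assms(1)
proof induction
  case (insert a A)
  have "(\<Sum>x\<in>A. \<Sum>y\<in>insert a A - {x}. f x y) = (\<Sum>x\<in>A. f a x + (\<Sum>y\<in>A - {x}. f x y))"
  proof (rule sum.cong)
    fix x assume "x \<in> A"
    then have "insert a A - {x} = insert a (A - {x})" using insert by auto
    then show "(\<Sum>y\<in>insert a A - {x}. f x y) = f a x + (\<Sum>y\<in>A - {x}. f x y)"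
      using insert assms(2)[of x a] by simp
  qed simp
  moreover have "insert a A - {a} = A" using insert by auto
  ultimately show ?case using insert by (simp add: sum.distrib flip: add.assoc)
qed simp

lemma boundary_boundary:
  assumes "finite V"
  shows "boundary V (boundary V c) \<tau> = 0"
proof -
  have "boundary V (boundary V c) \<tau>
      = (\<Sum>x\<in>V - \<tau>. \<Sum>y\<in>V - \<tau> - {x}. c (insert y (insert x \<tau>)))"
    unfolding boundary_def by (intro sum.cong) auto
  also have "\<dots> = 0"
    using assms by (intro sum_off_diagonal_symmetric) (auto simp: insert_commute)
  finally show ?thesis .
qed

lemma boundary_add:
  "boundary V (\<lambda>\<sigma>. a \<sigma> + b \<sigma>) \<tau> = boundary V a \<tau> + boundary V b \<tau>"
  by (simp add: boundary_def sum.distrib)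

text \<open>
  The join of the simplex \<open>e\<close> with the chain \<open>u\<close>. The following three lemmas are the Leibniz rule
  \<open>\<partial>(e * u) = \<partial>e * u + e * \<partial>u\<close>, split according to how much of \<open>e\<close> lies in \<open>\<tau>\<close>.
\<close>

definition join :: "'a set \<Rightarrow> ('a set \<Rightarrow> bit) \<Rightarrow> 'a set \<Rightarrow> bit" where
  "join e u \<tau> = (if e \<subseteq> \<tau> then u (\<tau> - e) else 0)"

lemma boundary_join_superset:
  assumes "finite V" "e \<subseteq> \<tau>" "\<And>\<sigma>. u \<sigma> \<noteq> 0 \<Longrightarrow> \<sigma> \<inter> e = {}"
  shows "boundary V (join e u) \<tau> = boundary V u (\<tau> - e)"
proof -
  have "boundary V (join e u) \<tau> = (\<Sum>x\<in>V - \<tau>. u (insert x (\<tau> - e)))"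
    unfolding boundary_def join_def using assms(2)
    by (intro sum.cong) (auto intro!: arg_cong[where f = u])
  also have "\<dots> = boundary V u (\<tau> - e)"
    unfolding boundary_def using assms by (intro sum.mono_neutral_left) blast+
  finally show ?thesis .
qed

lemma boundary_join_facet:
  assumes "finite V" "x \<in> V" "e - \<tau> = {x}"
  shows "boundary V (join e u) \<tau> = u (\<tau> - e)"
proof -
  have "boundary V (join e u) \<tau> = (\<Sum>y\<in>{x}. join e u (insert y \<tau>))"
    unfolding boundary_def using assms
    by (intro sum.mono_neutral_right) (auto simp: join_def)
  moreover have "insert x \<tau> - e = \<tau> - e" "e \<subseteq> insert x \<tau>" using assms by auto
  ultimately show ?thesis by (simp add: join_def)
qed

lemma boundary_join_other:
  assumes "\<not> e \<subseteq> \<tau>" "\<And>x. e - \<tau> \<noteq> {x}"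
  shows "boundary V (join e u) \<tau> = 0"
proof -
  have "\<not> e \<subseteq> insert y \<tau>" for y using assms(1) assms(2)[of y] by auto
  then show ?thesis by (simp add: boundary_def join_def)
qed

lemma connected_upto_cone:
  assumes "finite V" "x \<in> V" and cone: "\<And>\<sigma>. \<sigma> \<in> K \<Longrightarrow> finite \<sigma> \<and> insert x \<sigma> \<in> K"
  shows "connected_upto V k K"
  unfolding connected_upto_def
proof (intro allI impI, elim conjE)
  fix s z assume z: "chain s K z" "\<forall>\<tau>. boundary V z \<tau> = 0"
  let ?w = "join {x} z"
  have "chain (Suc s) K ?w"
    unfolding chain_def
  proof (intro allI impI)
    fix \<sigma> assume "?w \<sigma> \<noteq> 0"
    then have "x \<in> \<sigma>" "z (\<sigma> - {x}) \<noteq> 0" by (auto simp: join_def split: if_splits)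
    then have "\<sigma> - {x} \<in> K" "card (\<sigma> - {x}) = s" using z(1) by (auto simp: chain_def)
    then have "finite (\<sigma> - {x})" "insert x (\<sigma> - {x}) \<in> K" using cone by blast+
    then show "\<sigma> \<in> K \<and> card \<sigma> = Suc s"
      using \<open>x \<in> \<sigma>\<close> \<open>card (\<sigma> - {x}) = s\<close> using card_Suc_Diff1[of \<sigma> x] by (simp add: insert_absorb)
  qed
  moreover have "boundary V ?w \<tau> = z \<tau>" for \<tau>
  proof (cases "x \<in> \<tau>")
    case True
    have eq: "V - (\<tau> - {x}) = insert x (V - \<tau>)" using True \<open>x \<in> V\<close> by auto
    have "z \<tau> + (\<Sum>y\<in>V - \<tau>. z (insert y (\<tau> - {x}))) = boundary V z (\<tau> - {x})"
      unfolding boundary_def eq using True assms(1) by (simp add: insert_absorb)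
    also have "\<dots> = 0" using z(2) by simp
    finally have "(\<Sum>y\<in>V - \<tau>. z (insert y (\<tau> - {x}))) = z \<tau>"
      by (cases "z \<tau>"; cases "(\<Sum>y\<in>V - \<tau>. z (insert y (\<tau> - {x})))") auto
    moreover have "boundary V ?w \<tau> = (\<Sum>y\<in>V - \<tau>. z (insert y (\<tau> - {x})))"
      unfolding boundary_def join_def using True
      by (intro sum.cong) (auto intro!: arg_cong[where f = z])
    ultimately show ?thesis by simp
  next
    case False
    then show ?thesis
      using boundary_join_facet[OF assms(1,2), of "{x}" \<tau> z] by auto
  qed
  ultimately show "\<exists>w. chain (Suc s) K w \<and> boundary V w = z" by blast
qed

section \<open>Eliminating a vertex or a missing face\<close>

definition link :: "'a set \<Rightarrow> 'a set set \<Rightarrow> 'a set set" where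
  "link e K = {\<sigma>. \<sigma> \<inter> e = {} \<and> \<sigma> \<union> e \<in> K}"

text \<open>
  The simplices of \<open>w\<close> that contain \<open>e\<close> have the form \<open>\<sigma> \<union> e\<close> with \<open>\<sigma>\<close> in the link of \<open>e\<close>. As \<open>\<partial>w\<close> has no
  term containing \<open>e\<close>, these \<open>\<sigma>\<close> form a cycle in the link. If \<open>u\<close> fills this cycle, then adding
  \<open>\<partial>(e * u)\<close> removes all terms of \<open>w\<close> that contain \<open>e\<close>. Both elimination rules are instances: for a
  vertex, \<open>w\<close> is a cycle to be moved into the deletion; for a missing face, \<open>w\<close> is a filling to be moved
  off that face.
\<close>

lemma push_off:
  assumes V: "finite V" "complex_on V K"
    and e: "e \<subseteq> V" "e \<noteq> {}"
    and con: "connected_upto V k (link e K)"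
    and w: "chain s K w" "\<And>\<tau>. e \<subseteq> \<tau> \<Longrightarrow> boundary V w \<tau> = 0"
    and s: "s < k + card e"
  obtains u where "chain (Suc s) K u"
    "chain s {\<sigma> \<in> K. \<not> e \<subseteq> \<sigma>} (\<lambda>\<sigma>. w \<sigma> + boundary V u \<sigma>)"
proof (cases "card e \<le> s")
  case False
  have fin: "finite \<sigma>" if "\<sigma> \<in> K" for \<sigma> using V that by (rule complex_on_finite)
  have "\<not> e \<subseteq> \<sigma>" if "w \<sigma> \<noteq> 0" for \<sigma>
  proof
    assume "e \<subseteq> \<sigma>"
    then have "card e \<le> card \<sigma>" using that w(1) fin by (auto simp: chain_def dest!: card_mono[rotated])
    then show False using that w(1) False by (auto simp: chain_def)
  qed
  then have "chain s {\<sigma> \<in> K. \<not> e \<subseteq> \<sigma>} (\<lambda>\<sigma>. w \<sigma> + boundary V (\<lambda>_. 0) \<sigma>)"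
    using w(1) by (auto simp: chain_def boundary_def)
  moreover have "chain (Suc s) K (\<lambda>_. 0)" by (simp add: chain_def)
  ultimately show ?thesis using that by blast
next
  case True
  have fin: "finite \<sigma>" if "\<sigma> \<in> K" for \<sigma> using V that by (rule complex_on_finite)
  have fe: "finite e" using e V finite_subset by blast
  \<comment> \<open>The trace of \<open>w\<close> in the link of \<open>e\<close>.\<close>
  define a where "a = (\<lambda>\<tau>. if \<tau> \<inter> e = {} then w (\<tau> \<union> e) else 0)"
  have a: "chain (s - card e) (link e K) a"
    unfolding chain_def
  proof (intro allI impI)
    fix \<tau> assume "a \<tau> \<noteq> 0"
    then have *: "\<tau> \<inter> e = {}" "w (\<tau> \<union> e) \<noteq> 0" by (auto simp: a_def split: if_splits)
    then have **: "\<tau> \<union> e \<in> K" "card (\<tau> \<union> e) = s" using w(1) by (auto simp: chain_def)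
    then have "finite \<tau>" using fin by blast
    then have "card \<tau> = s - card e" using * ** fe by (simp add: card_Un_disjoint)
    then show "\<tau> \<in> link e K \<and> card \<tau> = s - card e" using * ** by (simp add: link_def)
  qed
  have cyc: "boundary V a \<tau> = 0" for \<tau>
  proof (cases "\<tau> \<inter> e = {}")
    case False
    then show ?thesis by (auto simp: boundary_def a_def)
  next
    case True
    have "boundary V a \<tau> = (\<Sum>y\<in>V - (\<tau> \<union> e). a (insert y \<tau>))"
      unfolding boundary_def using V by (intro sum.mono_neutral_right) (auto simp: a_def)
    also have "\<dots> = boundary V w (\<tau> \<union> e)"
      unfolding boundary_def by (intro sum.cong) (use True in \<open>auto simp: a_def\<close>)
    also have "\<dots> = 0" using w(2) by auto
    finally show ?thesis .
  qed
  have "s - card e < k" using s True by simp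
  then obtain u where u: "chain (Suc (s - card e)) (link e K) u" "boundary V u = a"
    using con a cyc unfolding connected_upto_def by blast
  have u0: "\<sigma> \<inter> e = {}" if "u \<sigma> \<noteq> 0" for \<sigma>
    using u(1) that by (auto simp: chain_def link_def)
  have "chain (Suc s) K (join e u)"
    unfolding chain_def
  proof (intro allI impI)
    fix \<sigma> assume "join e u \<sigma> \<noteq> 0"
    then have *: "e \<subseteq> \<sigma>" "u (\<sigma> - e) \<noteq> 0" by (auto simp: join_def split: if_splits)
    then have **: "\<sigma> - e \<union> e \<in> K" "card (\<sigma> - e) = Suc (s - card e)"
      using u(1) by (auto simp: chain_def link_def)
    moreover have "\<sigma> - e \<union> e = \<sigma>" using * by auto
    ultimately show "\<sigma> \<in> K \<and> card \<sigma> = Suc s"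
      using * True fe by (simp add: card_Diff_subset)
  qed
  moreover have "chain s {\<sigma> \<in> K. \<not> e \<subseteq> \<sigma>} (\<lambda>\<sigma>. w \<sigma> + boundary V (join e u) \<sigma>)"
    unfolding chain_def
  proof (intro allI impI)
    fix \<tau> assume nz: "w \<tau> + boundary V (join e u) \<tau> \<noteq> 0"
    have ne: "\<not> e \<subseteq> \<tau>"
    proof
      assume sub: "e \<subseteq> \<tau>"
      then have "boundary V (join e u) \<tau> = a (\<tau> - e)"
        using boundary_join_superset[OF V(1) sub u0] u(2) by metis
      also have "\<dots> = w \<tau>" using sub by (auto simp: a_def Un_absorb2)
      finally show False using nz by simp
    qed
    show "\<tau> \<in> {\<sigma> \<in> K. \<not> e \<subseteq> \<sigma>} \<and> card \<tau> = s"
    proof (cases "w \<tau> = 0")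
      case False
      then show ?thesis using w(1) ne by (auto simp: chain_def)
    next
      case True
      then have nz': "boundary V (join e u) \<tau> \<noteq> 0" using nz by simp
      then obtain x where x: "e - \<tau> = {x}" using boundary_join_other[OF ne] by metis
      then have "x \<in> V" using e by blast
      then have "u (\<tau> - e) \<noteq> 0"
        using nz' boundary_join_facet[OF V(1) _ x, of u] by simp
      then have *: "\<tau> - e \<union> e \<in> K" "card (\<tau> - e) = Suc (s - card e)"
        using u(1) by (auto simp: chain_def link_def)
      have "\<tau> \<in> K" using complex_on_subset[OF V(2) *(1), of \<tau>] by auto
      have "e \<inter> \<tau> = e - {x}" "x \<in> e" using x by auto
      then have "card (e \<inter> \<tau>) = card e - 1" "card e > 0" using fe by (auto simp: card_gt_0_iff)
      moreover have "card \<tau> = card (\<tau> - e) + card (e \<inter> \<tau>)"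
        using card_Int_Diff[OF fin[OF \<open>\<tau> \<in> K\<close>], of e] by (simp add: Int_commute)
      ultimately show ?thesis using \<open>\<tau> \<in> K\<close> ne * \<open>card e \<le> s\<close> by auto
    qed
  qed
  ultimately show ?thesis using that by blast
qed

lemma connected_upto_vertex:
  assumes V: "finite V" "complex_on V K"
    and v: "v \<in> V"
    and del: "connected_upto V k {\<sigma> \<in> K. v \<notin> \<sigma>}"
    and lk: "connected_upto V (k - 1) (link {v} K)"
  shows "connected_upto V k K"
  unfolding connected_upto_def
proof (intro allI impI, elim conjE)
  fix s z assume s: "s < k" and z: "chain s K z" "\<forall>\<tau>. boundary V z \<tau> = 0"
  have "s < k - 1 + card {v}" using s by simp
  then obtain u where u: "chain (Suc s) K u"
    "chain s {\<sigma> \<in> K. \<not> {v} \<subseteq> \<sigma>} (\<lambda>\<sigma>. z \<sigma> + boundary V u \<sigma>)"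
    using push_off[OF V _ _ lk z(1)] v z(2) by auto
  have "boundary V (\<lambda>\<sigma>. z \<sigma> + boundary V u \<sigma>) \<tau> = 0" for \<tau>
    using z(2) V(1) by (simp add: boundary_add boundary_boundary)
  moreover have "chain s {\<sigma> \<in> K. v \<notin> \<sigma>} (\<lambda>\<sigma>. z \<sigma> + boundary V u \<sigma>)" using u(2) by simp
  ultimately obtain w where w: "chain (Suc s) {\<sigma> \<in> K. v \<notin> \<sigma>} w"
    "boundary V w = (\<lambda>\<sigma>. z \<sigma> + boundary V u \<sigma>)"
    using del s unfolding connected_upto_def by blast
  have "chain (Suc s) K (\<lambda>\<sigma>. w \<sigma> + u \<sigma>)"
    using w(1) u(1) by (intro chain_add) (auto simp: chain_def)
  moreover have "boundary V (\<lambda>\<sigma>. w \<sigma> + u \<sigma>) = z"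
    by (rule ext) (simp add: boundary_add w(2) bit_add_cancel)
  ultimately show "\<exists>w. chain (Suc s) K w \<and> boundary V w = z" by blast
qed

lemma connected_upto_missing_face:
  assumes V: "finite V" "complex_on V K"
    and e: "e \<subseteq> V" "e \<noteq> {}"
    and full: "connected_upto V k K"
    and lk: "connected_upto V (k - (card e - 1)) (link e K)"
  shows "connected_upto V k {\<sigma> \<in> K. \<not> e \<subseteq> \<sigma>}"
  unfolding connected_upto_def
proof (intro allI impI, elim conjE)
  fix s z assume s: "s < k" and z: "chain s {\<sigma> \<in> K. \<not> e \<subseteq> \<sigma>} z" "\<forall>\<tau>. boundary V z \<tau> = 0"
  have "chain s K z" using z(1) by (auto simp: chain_def)
  then obtain w where w: "chain (Suc s) K w" "boundary V w = z"
    using full s z(2) unfolding connected_upto_def by blast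
  have "boundary V w \<tau> = 0" if "e \<subseteq> \<tau>" for \<tau>
    using that z(1) w(2) by (auto simp: chain_def)
  moreover have "card e > 0" using e V finite_subset[of e V] by (simp add: card_gt_0_iff)
  then have "Suc s < k - (card e - 1) + card e" using s by linarith
  ultimately obtain u where u: "chain (Suc (Suc s)) K u"
    "chain (Suc s) {\<sigma> \<in> K. \<not> e \<subseteq> \<sigma>} (\<lambda>\<sigma>. w \<sigma> + boundary V u \<sigma>)"
    using push_off[OF V e lk w(1)] by blast
  have "boundary V (\<lambda>\<sigma>. w \<sigma> + boundary V u \<sigma>) = z"
    using V(1) w(2) by (auto simp: boundary_add boundary_boundary)
  then show "\<exists>w. chain (Suc s) {\<sigma> \<in> K. \<not> e \<subseteq> \<sigma>} w \<and> boundary V w = z" using u(2) by blast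
qed

section \<open>Hall's theorem for simplicial complexes\<close>

text \<open>
  The coboundary is adjoint to the boundary. With \<open>r\<close> the indicator of the sets of given colours, it turns
  a count of rainbow facets into a count of rainbow simplices.
\<close>

lemma pairing_boundary:
  fixes r c :: "'a set \<Rightarrow> bit"
  assumes "finite V" "\<And>\<sigma>. c \<sigma> \<noteq> 0 \<Longrightarrow> \<sigma> \<subseteq> V"
  shows "(\<Sum>\<tau>\<in>Pow V. r \<tau> * boundary V c \<tau>) = (\<Sum>\<sigma>\<in>Pow V. (\<Sum>x\<in>\<sigma>. r (\<sigma> - {x})) * c \<sigma>)"
proof -
  have fin: "finite \<sigma>" if "\<sigma> \<in> Pow V" for \<sigma> using that assms(1) finite_subset by auto
  have "(\<Sum>\<tau>\<in>Pow V. r \<tau> * boundary V c \<tau>)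
      = (\<Sum>(\<tau>, x)\<in>(SIGMA \<tau>:Pow V. V - \<tau>). r \<tau> * c (insert x \<tau>))"
    using assms(1) by (simp add: boundary_def sum_distrib_left sum.Sigma)
  also have "\<dots> = (\<Sum>(\<sigma>, x)\<in>(SIGMA \<sigma>:Pow V. \<sigma>). r (\<sigma> - {x}) * c \<sigma>)"
    by (rule sum.reindex_bij_witness[where i = "\<lambda>(\<sigma>, x). (\<sigma> - {x}, x)" and j = "\<lambda>(\<tau>, x). (insert x \<tau>, x)"])
      (auto simp: insert_absorb)
  also have "\<dots> = (\<Sum>\<sigma>\<in>Pow V. (\<Sum>x\<in>\<sigma>. r (\<sigma> - {x})) * c \<sigma>)"
    using assms(1) fin by (simp add: sum_distrib_right sum.Sigma[symmetric])
  finally show ?thesis .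
qed

text \<open>
  A chain map from the simplex on the colour set \<open>J\<close> to \<open>K\<close> that respects colours: each face \<open>I\<close> is sent to
  a chain on vertices with colours in \<open>I\<close>. It is built up by the size of \<open>I\<close>. The images of the facets of \<open>I\<close>
  add up to a cycle, which bounds by the connectivity assumed for \<open>I\<close>.
\<close>

lemma filling_system:
  fixes col :: "'a \<Rightarrow> 'b"
  assumes "finite V" "finite J" "{} \<in> K"
    and con: "\<And>I. I \<subseteq> J \<Longrightarrow> I \<noteq> {} \<Longrightarrow> connected_upto V (card I) {\<sigma> \<in> K. col ` \<sigma> \<subseteq> I}"
  shows "\<exists>c. c {} = (\<lambda>\<sigma>. of_bool (\<sigma> = {}))
    \<and> (\<forall>I\<subseteq>J. chain (card I) {\<sigma> \<in> K. col ` \<sigma> \<subseteq> I} (c I)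
         \<and> boundary V (c I) = (\<lambda>\<tau>. \<Sum>i\<in>I. c (I - {i}) \<tau>))"
proof -
  let ?good = "\<lambda>c I. chain (card I) {\<sigma> \<in> K. col ` \<sigma> \<subseteq> I} (c I)
    \<and> boundary V (c I) = (\<lambda>\<tau>. \<Sum>i\<in>I. c (I - {i}) \<tau>)"
  have "\<exists>c. c {} = (\<lambda>\<sigma>. of_bool (\<sigma> = {})) \<and> (\<forall>I\<subseteq>J. card I \<le> n \<longrightarrow> ?good c I)" for n
  proof (induction n)
    case 0
    let ?c = "\<lambda>_. (\<lambda>\<sigma>. of_bool (\<sigma> = {}) :: bit)"
    have "?good ?c I" if "I \<subseteq> J" "card I \<le> 0" for I
    proof -
      have "I = {}" using that assms(2) finite_subset by fastforce
      then show ?thesis using \<open>{} \<in> K\<close> by (auto simp: chain_def boundary_def)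
    qed
    then show ?case by (intro exI[of _ ?c]) blast
  next
    case (Suc n)
    then obtain c where c: "c {} = (\<lambda>\<sigma>. of_bool (\<sigma> = {}))" "\<And>I. I \<subseteq> J \<Longrightarrow> card I \<le> n \<Longrightarrow> ?good c I"
      by blast
    have "\<exists>w. chain (card I) {\<sigma> \<in> K. col ` \<sigma> \<subseteq> I} w \<and> boundary V w = (\<lambda>\<tau>. \<Sum>i\<in>I. c (I - {i}) \<tau>)"
      if I: "I \<subseteq> J" "card I = Suc n" for I
    proof -
      have fI: "finite I" using I by (auto intro: card_ge_0_finite)
      have card: "card (I - {i}) = n" if "i \<in> I" for i using that I fI by simp
      let ?z = "\<lambda>\<tau>. \<Sum>i\<in>I. c (I - {i}) \<tau>"
      have "chain n {\<sigma> \<in> K. col ` \<sigma> \<subseteq> I} ?z"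
        unfolding chain_def
      proof (intro allI impI)
        fix \<sigma> assume "?z \<sigma> \<noteq> 0"
        then obtain i where i: "i \<in> I" "c (I - {i}) \<sigma> \<noteq> 0" by (meson sum.neutral)
        then have "chain n {\<sigma> \<in> K. col ` \<sigma> \<subseteq> I - {i}} (c (I - {i}))"
          using c(2)[of "I - {i}"] I card by auto
        then show "\<sigma> \<in> {\<sigma> \<in> K. col ` \<sigma> \<subseteq> I} \<and> card \<sigma> = n" using i by (auto simp: chain_def)
      qed
      moreover have "boundary V ?z \<tau> = 0" for \<tau>
      proof -
        have "boundary V ?z \<tau> = (\<Sum>i\<in>I. boundary V (c (I - {i})) \<tau>)"
          unfolding boundary_def by (rule sum.swap)
        also have "\<dots> = (\<Sum>i\<in>I. \<Sum>j\<in>I - {i}. c (I - {i} - {j}) \<tau>)"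
        proof (rule sum.cong)
          fix i assume "i \<in> I"
          then show "boundary V (c (I - {i})) \<tau> = (\<Sum>j\<in>I - {i}. c (I - {i} - {j}) \<tau>)"
            using c(2)[of "I - {i}"] I card by fastforce
        qed simp
        also have "\<dots> = 0"
        proof (rule sum_off_diagonal_symmetric[OF fI])
          fix i j
          have "I - {i} - {j} = I - {j} - {i}" by blast
          then show "c (I - {i} - {j}) \<tau> = c (I - {j} - {i}) \<tau>" by presburger
        qed
        finally show ?thesis .
      qed
      moreover have "n < card I" "I \<noteq> {}" using I by auto
      ultimately show ?thesis using connected_uptoD[OF con[OF I(1)], of n ?z] I by auto
    qed
    then have "\<forall>I. \<exists>w. I \<subseteq> J \<and> card I = Suc n \<longrightarrow>
        chain (card I) {\<sigma> \<in> K. col ` \<sigma> \<subseteq> I} w \<and> boundary V w = (\<lambda>\<tau>. \<Sum>i\<in>I. c (I - {i}) \<tau>)"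
      by simp
    from choice[OF this] obtain f where f: "I \<subseteq> J \<Longrightarrow> card I = Suc n \<Longrightarrow>
        chain (card I) {\<sigma> \<in> K. col ` \<sigma> \<subseteq> I} (f I) \<and> boundary V (f I) = (\<lambda>\<tau>. \<Sum>i\<in>I. c (I - {i}) \<tau>)"
      for I by auto
    define c' where "c' I = (if card I = Suc n then f I else c I)" for I
    have "?good c' I" if I: "I \<subseteq> J" "card I \<le> Suc n" for I
    proof -
      have "finite I" using I assms(2) finite_subset by blast
      then have eq: "c' (I - {i}) = c (I - {i})" if "i \<in> I" for i
        using that I by (auto simp: c'_def)
      then have "(\<lambda>\<tau>. \<Sum>i\<in>I. c' (I - {i}) \<tau>) = (\<lambda>\<tau>. \<Sum>i\<in>I. c (I - {i}) \<tau>)" by auto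
      moreover have "?good c I" if "card I \<noteq> Suc n" using c(2) I that by auto
      ultimately show ?thesis using f[OF I(1)] by (auto simp: c'_def)
    qed
    moreover have "c' {} = (\<lambda>\<sigma>. of_bool (\<sigma> = {}))" using c(1) by (simp add: c'_def)
    ultimately show ?case by blast
  qed
  from this[of "card J"] obtain c where "c {} = (\<lambda>\<sigma>. of_bool (\<sigma> = {}))"
    and c: "\<forall>I\<subseteq>J. card I \<le> card J \<longrightarrow> ?good c I" by blast
  moreover have "card I \<le> card J" if "I \<subseteq> J" for I using that assms(2) card_mono by blast
  ultimately show ?thesis by (intro exI[of _ c]) simp
qed

text \<open>
  The double counting of Sperner's lemma. A rainbow simplex has exactly one facet that misses just the
  colour \<open>i\<close>. If a simplex is not rainbow but has such a facet, then some colour occurs exactly twice, and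
  removing either of its two vertices leaves such a facet.
\<close>

lemma sum_rainbow_facets:
  fixes col :: "'a \<Rightarrow> 'b"
  assumes "finite I" "finite \<sigma>" "card \<sigma> = card I" "col ` \<sigma> \<subseteq> I" "i \<in> I"
  shows "(\<Sum>x\<in>\<sigma>. of_bool (col ` (\<sigma> - {x}) = I - {i})) = (of_bool (col ` \<sigma> = I) :: bit)"
proof -
  define T where "T = {x \<in> \<sigma>. col ` (\<sigma> - {x}) = I - {i}}"
  have "(\<Sum>x\<in>\<sigma>. of_bool (col ` (\<sigma> - {x}) = I - {i})) = (\<Sum>x\<in>T. 1 :: bit)"
    unfolding T_def using assms(2) by (intro sum.mono_neutral_cong_right) auto
  also have "\<dots> = of_bool (col ` \<sigma> = I)"
  proof (cases "col ` \<sigma> = I")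
    case True
    then have inj: "inj_on col \<sigma>" using assms by (auto intro: eq_card_imp_inj_on)
    obtain x where x: "x \<in> \<sigma>" "col x = i" using True assms(5) by auto
    have "col ` (\<sigma> - {y}) = I - {col y}" if "y \<in> \<sigma>" for y
      using True inj that by (auto simp: inj_on_def)
    then have "y \<in> T \<longleftrightarrow> y = x" for y
      using x inj assms(5) by (auto simp: T_def inj_on_def)
    then have "T = {x}" by blast
    then show ?thesis using True by simp
  next
    case False
    have "(\<Sum>x\<in>T. 1 :: bit) = 0"
    proof (cases "T = {}")
      case ne: False
      then obtain x where x: "x \<in> \<sigma>" "col ` (\<sigma> - {x}) = I - {i}" by (auto simp: T_def)
      have "col x \<noteq> i" using False x assms(5) by auto
      then have "col x \<in> col ` (\<sigma> - {x})" using x assms(4) by auto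
      then obtain y where y: "y \<in> \<sigma>" "y \<noteq> x" "col y = col x" by force
      have image_remove: "col ` (\<sigma> - {a}) = col ` \<sigma>"
        if "a \<in> \<sigma>" "b \<in> \<sigma>" "b \<noteq> a" "col b = col a" for a b
      proof -
        have "col a \<in> col ` (\<sigma> - {a})" using that by (intro image_eqI[of _ _ b]) auto
        moreover have "col ` \<sigma> = insert (col a) (col ` (\<sigma> - {a}))" using that(1) by auto
        ultimately show ?thesis by (simp add: insert_absorb)
      qed
      have "z \<in> T \<longleftrightarrow> z = x \<or> z = y" for z
      proof
        assume z: "z \<in> T"
        then have "z \<in> \<sigma>" "col ` (\<sigma> - {z}) = I - {i}" by (auto simp: T_def)
        then have "card (col ` (\<sigma> - {z})) = card (\<sigma> - {z})"
          using assms(1-3,5) by (simp only: card_Diff_singleton)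
        then have "inj_on col (\<sigma> - {z})" using assms(2) by (auto intro: eq_card_imp_inj_on)
        then show "z = x \<or> z = y" using x(1) y by (auto simp: inj_on_def)
      next
        have "col ` (\<sigma> - {y}) = col ` (\<sigma> - {x})" 
          using image_remove[OF y(1) x(1)] image_remove[OF x(1) y(1)] y(2,3) by simp
        moreover assume "z = x \<or> z = y"
        ultimately show "z \<in> T" using x y by (auto simp: T_def)
      qed
      then have "T = {x, y}" by blast
      then show ?thesis using y(2) by simp
    qed simp
    then show ?thesis using False by simp
  qed
  finally show ?thesis .
qed

text \<open>
  Hall's theorem for complexes. The number of rainbow simplices in the image of the face \<open>I\<close> of the colour
  simplex is odd: by double counting it has the same parity for \<open>I\<close> as for \<open>I - {i}\<close>, and the image of the
  empty face is the empty simplex.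
\<close>

theorem rainbow_simplex:
  fixes col :: "'a \<Rightarrow> 'b"
  assumes "finite V" "finite J" "complex_on V K" "{} \<in> K"
    and con: "\<And>I. I \<subseteq> J \<Longrightarrow> I \<noteq> {} \<Longrightarrow> connected_upto V (card I) {\<sigma> \<in> K. col ` \<sigma> \<subseteq> I}"
  shows "\<exists>\<sigma>\<in>K. card \<sigma> = card J \<and> col ` \<sigma> = J"
proof -
  have "\<exists>c. c {} = (\<lambda>\<sigma>. of_bool (\<sigma> = {}))
    \<and> (\<forall>I\<subseteq>J. chain (card I) {\<sigma> \<in> K. col ` \<sigma> \<subseteq> I} (c I)
         \<and> boundary V (c I) = (\<lambda>\<tau>. \<Sum>i\<in>I. c (I - {i}) \<tau>))"
    by (rule filling_system[OF assms(1,2,4)]) (rule con)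
  then obtain c where c0: "c {} = (\<lambda>\<sigma>. of_bool (\<sigma> = {}))"
    and c: "I \<subseteq> J \<Longrightarrow> chain (card I) {\<sigma> \<in> K. col ` \<sigma> \<subseteq> I} (c I)"
    and bd: "I \<subseteq> J \<Longrightarrow> boundary V (c I) = (\<lambda>\<tau>. \<Sum>i\<in>I. c (I - {i}) \<tau>)" for I
    by auto
  have sub: "\<sigma> \<subseteq> V" "finite \<sigma>" if "\<sigma> \<in> K" for \<sigma>
    using assms(1,3) that finite_subset by (auto simp: complex_on_def)
  define R where "R I = (\<Sum>\<sigma>\<in>Pow V. of_bool (col ` \<sigma> = I) * c I \<sigma>)" for I
  have step: "R (I - {i}) = R I" if I: "I \<subseteq> J" "i \<in> I" for I i
  proof -
    have fI: "finite I" using I assms(2) finite_subset by blast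
    have "R (I - {i}) = (\<Sum>\<tau>\<in>Pow V. of_bool (col ` \<tau> = I - {i}) * boundary V (c I) \<tau>)"
      unfolding R_def
    proof (rule sum.cong)
      fix \<tau> assume "\<tau> \<in> Pow V"
      \<comment> \<open>Only the facet that omits \<open>i\<close> can contribute, since a chain for \<open>I - {j}\<close> has no vertex
          of colour \<open>j\<close>.\<close>
      have "c (I - {j}) \<tau> = 0" if "col ` \<tau> = I - {i}" "j \<in> I - {i}" for j
      proof (rule ccontr)
        assume "c (I - {j}) \<tau> \<noteq> 0"
        then have "col ` \<tau> \<subseteq> I - {j}" using c[of "I - {j}"] I by (auto simp: chain_def)
        then show False using that by auto
      qed
      then have "(\<Sum>j\<in>I. c (I - {j}) \<tau>) = c (I - {i}) \<tau>" if "col ` \<tau> = I - {i}"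
        using that I fI by (simp add: sum.remove[of I i])
      then show "of_bool (col ` \<tau> = I - {i}) * c (I - {i}) \<tau>
          = of_bool (col ` \<tau> = I - {i}) * boundary V (c I) \<tau>"
        using bd[OF I(1)] by auto
    qed simp
    also have "\<dots> = (\<Sum>\<sigma>\<in>Pow V. (\<Sum>x\<in>\<sigma>. of_bool (col ` (\<sigma> - {x}) = I - {i})) * c I \<sigma>)"
      using assms(1) c[OF I(1)] sub by (intro pairing_boundary) (auto simp: chain_def)
    also have "\<dots> = R I"
      unfolding R_def
    proof (rule sum.cong)
      fix \<sigma> assume "\<sigma> \<in> Pow V"
      show "(\<Sum>x\<in>\<sigma>. of_bool (col ` (\<sigma> - {x}) = I - {i})) * c I \<sigma> = of_bool (col ` \<sigma> = I) * c I \<sigma>"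
      proof (cases "c I \<sigma> = 0")
        case False
        then have "\<sigma> \<in> K" "col ` \<sigma> \<subseteq> I" "card \<sigma> = card I" using c[OF I(1)] by (auto simp: chain_def)
        then show ?thesis using sum_rainbow_facets[OF fI _ _ _ I(2), of \<sigma> col] sub by simp
      qed simp
    qed simp
    finally show ?thesis .
  qed
  have "R I = 1" if "finite I" "I \<subseteq> J" for I
    using that
  proof (induction I)
    case empty
    have "R {} = (\<Sum>\<sigma>\<in>{{}}. of_bool (col ` \<sigma> = {}) * c {} \<sigma>)"
      unfolding R_def using assms(1) by (intro sum.mono_neutral_right) auto
    then show ?case by (simp add: c0)
  next
    case (insert i I)
    then show ?case using step[of "insert i I" i] by simp
  qed
  then have "R J \<noteq> 0" using assms(2) by auto
  then obtain \<sigma> where "of_bool (col ` \<sigma> = J) * c J \<sigma> \<noteq> 0"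
    unfolding R_def by (meson sum.neutral)
  then have "col ` \<sigma> = J" "c J \<sigma> \<noteq> 0" by (auto split: if_splits)
  then show ?thesis using c[of J] by (auto simp: chain_def)
qed

section \<open>Independence complexes of hypergraphs with bounded codegrees\<close>

text \<open>
  The independence complex of the hypergraph \<open>H\<close> on \<open>W\<close>.
\<close>

definition avoiding :: "'a set \<Rightarrow> 'a set set \<Rightarrow> 'a set set" where
  "avoiding W H = {\<sigma>. \<sigma> \<subseteq> W \<and> (\<forall>h\<in>H. \<not> h \<subseteq> \<sigma>)}"

text \<open>
  Contraction of an edge of maximal size. Proper subsets of \<open>e\<close>, instead of \<open>e\<close> itself, are removed from the
  edges. This turns every point of \<open>e\<close> into a singleton edge, which takes the points of \<open>e\<close> out of play while
  the ground set stays the same, so that they are counted among the blocked points.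
\<close>

definition contract :: "'a set \<Rightarrow> 'a set set \<Rightarrow> 'a set set" where
  "contract e H = {h - A | h A. h \<in> H \<and> A \<subset> e}"

text \<open>
  The function \<open>\<delta>\<close> bounds in how many ways a set of given size extends to an edge by one more point. For the
  empty set it bounds the singleton edges, that is, the points that are not vertices of the independence
  complex.
\<close>

definition codegrees_le :: "'a set \<Rightarrow> 'a set set \<Rightarrow> nat \<Rightarrow> (nat \<Rightarrow> nat) \<Rightarrow> bool" where
  "codegrees_le W H q \<delta> \<longleftrightarrow>
     (\<forall>D\<subseteq>W. card D < q \<longrightarrow> card {x \<in> W - D. insert x D \<in> H} \<le> \<delta> (card D))"

lemma complex_on_avoiding: "W \<subseteq> V \<Longrightarrow> complex_on V (avoiding W H)"
  by (fastforce simp: complex_on_def avoiding_def)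

lemma avoiding_remove:
  "e \<in> H \<Longrightarrow> {\<sigma> \<in> avoiding W (H - {e}). \<not> e \<subseteq> \<sigma>} = avoiding W H"
  by (auto simp: avoiding_def)

text \<open>
  Maximality of \<open>e\<close> excludes edges that properly contain \<open>e\<close>. Hence every other edge meets \<open>e\<close> in a proper
  subset, and removing proper subsets loses nothing. An edge properly inside \<open>e\<close> yields the empty edge after
  contraction, and then both sides are void.
\<close>

lemma link_avoiding:
  assumes e: "e \<in> H" "e \<subseteq> W" "e \<noteq> {}"
    and max: "\<And>h. h \<in> H \<Longrightarrow> finite h \<and> card h \<le> card e"
  shows "link e (avoiding W (H - {e})) = avoiding W (contract e H)"
proof (intro set_eqI iffI)
  fix \<sigma> assume "\<sigma> \<in> link e (avoiding W (H - {e}))"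
  then have \<sigma>: "\<sigma> \<inter> e = {}" "\<sigma> \<subseteq> W" "\<And>h. h \<in> H \<Longrightarrow> h \<noteq> e \<Longrightarrow> \<not> h \<subseteq> \<sigma> \<union> e"
    by (auto simp: link_def avoiding_def)
  have "\<not> h - A \<subseteq> \<sigma>" if "h \<in> H" "A \<subset> e" for h A
  proof
    assume sub: "h - A \<subseteq> \<sigma>"
    then have "h = e" using \<sigma>(3)[OF that(1)] that(2) by blast
    then show False using sub that(2) \<sigma>(1) by blast
  qed
  then show "\<sigma> \<in> avoiding W (contract e H)"
    using \<sigma>(2) by (auto simp: avoiding_def contract_def)
next
  fix \<sigma> assume "\<sigma> \<in> avoiding W (contract e H)"
  then have \<sigma>: "\<sigma> \<subseteq> W" "h \<in> H \<Longrightarrow> A \<subset> e \<Longrightarrow> \<not> h - A \<subseteq> \<sigma>" for h A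
    unfolding avoiding_def contract_def by blast+
  have "y \<notin> \<sigma>" if "y \<in> e" for y
    using \<sigma>(2)[OF e(1), of "e - {y}"] that by (auto simp: double_diff)
  moreover have "\<not> h \<subseteq> \<sigma> \<union> e" if h: "h \<in> H" "h \<noteq> e" for h
  proof
    assume sub: "h \<subseteq> \<sigma> \<union> e"
    have "h \<inter> e \<noteq> e"
    proof
      assume "h \<inter> e = e"
      then have "e \<subseteq> h" by blast
      then show False using max[OF h(1)] card_seteq[of h e] h(2) by blast
    qed
    then have "\<not> h - h \<inter> e \<subseteq> \<sigma>" by (intro \<sigma>(2)[OF h(1)]) blast
    then show False using sub by blast
  qed
  ultimately show "\<sigma> \<in> link e (avoiding W (H - {e}))"
    using \<sigma>(1) e(2) by (auto simp: link_def avoiding_def)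
qed

lemma sum_small_subsets:
  fixes f :: "nat \<Rightarrow> nat"
  assumes "finite e"
  shows "(\<Sum>A | A \<subseteq> e \<and> card A < n. f (card A)) = (\<Sum>i<n. (card e choose i) * f i)"
proof -
  have fin: "finite {A. A \<subseteq> e \<and> card A < n}" using assms by simp
  have "(\<Sum>i<n. (card e choose i) * f i)
      = (\<Sum>i<n. \<Sum>A | A \<in> {A. A \<subseteq> e \<and> card A < n} \<and> card A = i. f (card A))"
  proof (rule sum.cong)
    fix i assume "i \<in> {..<n}"
    then have "{A. A \<in> {A. A \<subseteq> e \<and> card A < n} \<and> card A = i} = {A. A \<subseteq> e \<and> card A = i}" by auto
    then show "(card e choose i) * f i
        = (\<Sum>A | A \<in> {A. A \<subseteq> e \<and> card A < n} \<and> card A = i. f (card A))"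
      using n_subsets[OF assms, of i] by simp
  qed simp
  also have "\<dots> = (\<Sum>A | A \<subseteq> e \<and> card A < n. f (card A))"
    using fin by (intro sum.group) auto
  finally show ?thesis by simp
qed

text \<open>
  An extension of \<open>D\<close> to an edge of the contraction comes from an extension of \<open>D \<union> A\<close> to an edge of \<open>H\<close>, for
  some proper subset \<open>A\<close> of \<open>e\<close>. Here \<open>|D| + |A| < q\<close> because edges have at most \<open>q\<close> points.
\<close>

lemma codegrees_contract:
  assumes "finite W" "e \<subseteq> W" "card e = q" and H: "\<And>h. h \<in> H \<Longrightarrow> h \<subseteq> W \<and> card h \<le> q"
    and deg: "codegrees_le W H q \<delta>"
  shows "codegrees_le W (contract e H) q (\<lambda>j. \<Sum>i<q - j. (q choose i) * \<delta> (i + j))"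
  unfolding codegrees_le_def
proof (intro allI impI)
  fix D assume D: "D \<subseteq> W" "card D < q"
  have fD: "finite D" and fe: "finite e" using D assms(1,2) finite_subset by blast+
  let ?A = "{A. A \<subseteq> e \<and> card A < q - card D}"
  let ?X = "\<lambda>A. {x \<in> W - (D \<union> A). insert x (D \<union> A) \<in> H}"
  have fA: "finite ?A" using fe by simp
  have "{x \<in> W - D. insert x D \<in> contract e H} \<subseteq> (\<Union>A\<in>{A \<in> ?A. A \<inter> D = {}}. ?X A)"
  proof
    fix x assume "x \<in> {x \<in> W - D. insert x D \<in> contract e H}"
    then obtain h A where x: "x \<in> W" "x \<notin> D" and h: "h \<in> H" "A \<subset> e" "insert x D = h - A"
      by (auto simp: contract_def)
    let ?B = "h \<inter> A"
    have eq: "insert x (D \<union> ?B) = h" and disj: "?B \<inter> D = {}" and xB: "x \<notin> ?B" using h(3) by auto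
    have "finite h" using H[OF h(1)] assms(1) finite_subset by blast
    then have "card h = card (insert x D) + card ?B"
      using card_Int_Diff[of h A] h(3) by simp
    then have "card ?B < q - card D" using conjunct2[OF H[OF h(1)]] x(2) fD by simp
    then have "?B \<in> {A \<in> ?A. A \<inter> D = {}}" using h(2) disj by auto
    moreover have "x \<in> ?X ?B" using x xB eq h(1) by simp
    ultimately show "x \<in> (\<Union>A\<in>{A \<in> ?A. A \<inter> D = {}}. ?X A)" by blast
  qed
  then have "card {x \<in> W - D. insert x D \<in> contract e H} \<le> card (\<Union>A\<in>{A \<in> ?A. A \<inter> D = {}}. ?X A)"
    by (intro card_mono[OF finite_subset[OF _ assms(1)]]) auto
  also have "\<dots> \<le> (\<Sum>A\<in>{A \<in> ?A. A \<inter> D = {}}. card (?X A))"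
    by (intro card_UN_le finite_subset[OF _ fA]) auto
  also have "\<dots> \<le> (\<Sum>A\<in>{A \<in> ?A. A \<inter> D = {}}. \<delta> (card A + card D))"
  proof (rule sum_mono)
    fix A assume A: "A \<in> {A \<in> ?A. A \<inter> D = {}}"
    then have "card (D \<union> A) = card A + card D"
      using fD fe finite_subset[of A e] by (subst card_Un_disjoint) auto
    moreover have "D \<union> A \<subseteq> W" using A D assms(2) by auto
    moreover have "card A + card D < q" using A by auto
    ultimately show "card (?X A) \<le> \<delta> (card A + card D)"
      using deg[unfolded codegrees_le_def, rule_format, of "D \<union> A"] by simp
  qed
  also have "\<dots> \<le> (\<Sum>A\<in>?A. \<delta> (card A + card D))"
    using fA by (intro sum_mono2) auto
  also have "\<dots> = (\<Sum>i<q - card D. (q choose i) * \<delta> (i + card D))"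
    using sum_small_subsets[OF fe, of "\<lambda>i. \<delta> (i + card D)"] assms(3) by simp
  finally show "card {x \<in> W - D. insert x D \<in> contract e H}
      \<le> (\<Sum>i<q - card D. (q choose i) * \<delta> (i + card D))" .
qed

lemma sum_triangle:
  fixes g :: "nat \<Rightarrow> nat \<Rightarrow> nat"
  shows "(\<Sum>j<n. \<Sum>i<n - j. g j i) = (\<Sum>m<n. \<Sum>j\<le>m. g j (m - j))"
proof -
  have "(\<Sum>j<n. \<Sum>i<n - j. g j i) = (\<Sum>(j, i)\<in>(SIGMA j:{..<n}. {..<n - j}). g j i)"
    by (simp add: sum.Sigma)
  also have "(SIGMA j:{..<n}. {..<n - j}) = {(j, i). j + i < n}" by auto
  finally show ?thesis by (simp add: sum.triangle_reindex)
qed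

text \<open>
  One step of the telescoping product: \<open>(q choose i) / ((q - 1) choose i) = q / (q - i)\<close>, and for
  \<open>q \<ge> i + j + 1\<close> this is at most \<open>(i + j + 1) / (j + 1)\<close>, its value at \<open>q = i + j + 1\<close>.
\<close>

lemma absorb_ratio:
  fixes i j q :: nat
  assumes "i + j < q"
  shows "(j + 1) * (q choose i) \<le> (i + j + 1) * ((q - 1) choose i)"
proof -
  have "q * (j + 1) \<le> (q - i) * (i + j + 1)"
  proof -
    obtain p where q: "q = i + j + 1 + p" using assms less_imp_Suc_add by force
    show ?thesis by (simp add: q algebra_simps)
  qed
  then have "q * (j + 1) * ((q - 1) choose i) \<le> (q - i) * (i + j + 1) * ((q - 1) choose i)"
    by (rule mult_right_mono) simp
  then have "(q - i) * ((j + 1) * (q choose i)) \<le> (q - i) * ((i + j + 1) * ((q - 1) choose i))"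
    using binomial_absorb_comp[of q i] by (metis (no_types, lifting) mult.assoc mult.commute)
  then show ?thesis using assms by simp
qed

text \<open>
  The quantity \<open>\<Sum>j<q. (j + 1) * (k choose j) * \<delta> j\<close> bounds the number of points that can end up blocked when
  \<open>k\<close> dimensions are left to pay with. Contracting an edge of size \<open>q\<close> lowers \<open>k\<close> by \<open>q - 1\<close> and
  replaces \<open>\<delta>\<close> by the bound of the contraction; the lemma says that the quantity does not grow.
\<close>

lemma contracted_budget:
  fixes q :: nat
  shows "(\<Sum>j<q. (j + 1) * (k choose j) * (\<Sum>i<q - j. (q choose i) * \<delta> (i + j)))
    \<le> (\<Sum>m<q. (m + 1) * ((k + (q - 1)) choose m) * \<delta> m)"
proof -
  have "(\<Sum>j<q. (j + 1) * (k choose j) * (\<Sum>i<q - j. (q choose i) * \<delta> (i + j)))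
      = (\<Sum>j<q. \<Sum>i<q - j. (j + 1) * (k choose j) * ((q choose i) * \<delta> (i + j)))"
    by (simp add: sum_distrib_left)
  also have "\<dots> = (\<Sum>m<q. \<Sum>j\<le>m. (j + 1) * (k choose j) * ((q choose (m - j)) * \<delta> (m - j + j)))"
    by (rule sum_triangle)
  also have "\<dots> \<le> (\<Sum>m<q. (m + 1) * ((k + (q - 1)) choose m) * \<delta> m)"
  proof (rule sum_mono)
    fix m assume m: "m \<in> {..<q}"
    have "(\<Sum>j\<le>m. (j + 1) * (k choose j) * ((q choose (m - j)) * \<delta> (m - j + j)))
        \<le> (\<Sum>j\<le>m. (m + 1) * \<delta> m * ((k choose j) * ((q - 1) choose (m - j))))"
    proof (rule sum_mono)
      fix j assume j: "j \<in> {..m}"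
      then have "(j + 1) * (q choose (m - j)) \<le> (m + 1) * ((q - 1) choose (m - j))"
        using absorb_ratio[of "m - j" j q] m by simp
      then have "(k choose j) * \<delta> m * ((j + 1) * (q choose (m - j)))
          \<le> (k choose j) * \<delta> m * ((m + 1) * ((q - 1) choose (m - j)))"
        by (rule mult_left_mono) simp
      then show "(j + 1) * (k choose j) * ((q choose (m - j)) * \<delta> (m - j + j))
          \<le> (m + 1) * \<delta> m * ((k choose j) * ((q - 1) choose (m - j)))"
        using j by (simp add: ac_simps del: mult_Suc mult_Suc_right)
    qed
    also have "\<dots> = (m + 1) * \<delta> m * ((k + (q - 1)) choose m)"
      by (subst vandermonde[symmetric]) (simp add: sum_distrib_left)
    finally show "(\<Sum>j\<le>m. (j + 1) * (k choose j) * ((q choose (m - j)) * \<delta> (m - j + j)))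
        \<le> (m + 1) * ((k + (q - 1)) choose m) * \<delta> m" by (simp add: algebra_simps)
  qed
  finally show ?thesis .
qed

lemma connected_upto_avoiding_singletons:
  assumes "finite V" "W \<subseteq> V" and H: "\<And>h. h \<in> H \<Longrightarrow> h \<subseteq> W \<and> card h \<le> 1"
    and x: "x \<in> W" "{x} \<notin> H"
  shows "connected_upto V k (avoiding W H)"
proof (rule connected_upto_cone[of V x])
  fix \<sigma> assume "\<sigma> \<in> avoiding W H"
  then have \<sigma>: "\<sigma> \<subseteq> W" "\<And>h. h \<in> H \<Longrightarrow> \<not> h \<subseteq> \<sigma>" by (auto simp: avoiding_def)
  have "\<not> h \<subseteq> insert x \<sigma>" if h: "h \<in> H" for h
  proof
    assume sub: "h \<subseteq> insert x \<sigma>"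
    have "\<not> h \<subseteq> \<sigma>" using \<sigma>(2)[OF h] .
    with sub have "x \<in> h" by auto
    moreover have "finite h" using H[OF h] finite_subset[OF _ finite_subset[OF assms(2,1)]] by simp
    ultimately have "h = {x}" using H[OF h] card_seteq[of h "{x}"] by auto
    then show False using h x by simp
  qed
  then show "finite \<sigma> \<and> insert x \<sigma> \<in> avoiding W H"
    using \<sigma>(1) x(1) finite_subset[OF \<sigma>(1) finite_subset[OF assms(2,1)]]
    by (auto simp: avoiding_def)
qed (use assms in auto)

text \<open>
  Edges are eliminated in order of decreasing size, each by the rule for missing faces. The nested inductions
  are on the maximal edge size, on the remaining dimensions \<open>k\<close> (which drop when an edge is contracted), and
  on the number of edges of maximal size (which drops when an edge is removed). When only singletons are left,
  the bound on \<open>card W\<close> provides a cone point.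
\<close>

theorem connected_upto_avoiding:
  fixes k q :: nat
  assumes V: "finite V" "W \<subseteq> V"
  shows "(\<And>h. h \<in> H \<Longrightarrow> h \<subseteq> W \<and> card h \<le> q) \<Longrightarrow> codegrees_le W H q \<delta> \<Longrightarrow>
    (\<Sum>j<q. (j + 1) * (k choose j) * \<delta> j) < card W \<Longrightarrow> connected_upto V (k + 1) (avoiding W H)"
proof (induction q arbitrary: H \<delta> k)
  case 0
  then obtain x where x: "x \<in> W" by fastforce
  have "{x} \<notin> H" using 0(1)[of "{x}"] by auto
  then show ?case using connected_upto_avoiding_singletons[OF V _ x] 0(1) by fastforce
next
  case (Suc p)
  show ?case
  proof (cases "p = 0")
    case True
    have "card {x \<in> W. {x} \<in> H} \<le> \<delta> 0"
      using Suc.prems(2) True by (auto simp: codegrees_le_def dest: spec[of _ "{}"])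
    then have "{x \<in> W. {x} \<in> H} \<noteq> W" using Suc.prems(3) True by auto
    then obtain x where x: "x \<in> W" "{x} \<notin> H" by blast
    show ?thesis using connected_upto_avoiding_singletons[OF V _ x] Suc.prems(1) True by auto
  next
    case False
    have fW: "finite W" using V finite_subset by blast
    show ?thesis using Suc.prems
    proof (induction k arbitrary: H \<delta> rule: less_induct)
      case (less k)
      note contract_IH = less.IH
      show ?case using less.prems
      proof (induction "card {h \<in> H. card h = Suc p}" arbitrary: H)
        case 0
        have "finite H" using 0(2) fW finite_subset[of H "Pow W"] by auto
        then have "{h \<in> H. card h = Suc p} = {}" using 0(1) by simp
        then have "h \<subseteq> W \<and> card h \<le> p" if "h \<in> H" for h using 0(2)[OF that] that by auto
        moreover have "codegrees_le W H p \<delta>" using 0(3) by (auto simp: codegrees_le_def)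
        moreover have "(\<Sum>j<p. (j + 1) * (k choose j) * \<delta> j) < card W" using 0(4) by simp
        ultimately show ?case by (rule Suc.IH)
      next
        case (Suc n)
        have finH: "finite H" using Suc.prems(1) fW finite_subset[of H "Pow W"] by auto
        have "{h \<in> H. card h = Suc p} \<noteq> {}"
          using Suc.hyps(2) card.empty by (metis nat.distinct(1))
        then obtain e where e: "e \<in> H" "card e = Suc p" by blast
        have eW: "e \<subseteq> W" "e \<noteq> {}" using Suc.prems(1) e by auto
        have fin: "finite h" if "h \<in> H" for h using Suc.prems(1)[OF that] fW finite_subset by blast
        have "{h \<in> H - {e}. card h = Suc p} = {h \<in> H. card h = Suc p} - {e}" by auto
        then have "n = card {h \<in> H - {e}. card h = Suc p}" using Suc.hyps(2) e finH by simp
        moreover have "codegrees_le W (H - {e}) (Suc p) \<delta>"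
          unfolding codegrees_le_def
        proof (intro allI impI)
          fix D assume D: "D \<subseteq> W" "card D < Suc p"
          have "card {x \<in> W - D. insert x D \<in> H - {e}} \<le> card {x \<in> W - D. insert x D \<in> H}"
            using fW by (intro card_mono) auto
          also have "\<dots> \<le> \<delta> (card D)" using Suc.prems(2) D by (simp add: codegrees_le_def)
          finally show "card {x \<in> W - D. insert x D \<in> H - {e}} \<le> \<delta> (card D)" .
        qed
        ultimately have full: "connected_upto V (k + 1) (avoiding W (H - {e}))"
          using Suc.hyps(1)[of "H - {e}"] Suc.prems by auto
        have "connected_upto V (k + 1 - (card e - 1)) (avoiding W (contract e H))"
        \<comment> \<open>An edge too expensive for the remaining dimensions requires nothing of its link.\<close>
        proof (cases "p \<le> k")
          case True
          have "h \<subseteq> W \<and> card h \<le> Suc p" if hc: "h \<in> contract e H" for h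
          proof -
            obtain h' A where h: "h' \<in> H" "h = h' - A" using hc unfolding contract_def by blast
            then have "card h \<le> card h'" using fin by (auto intro: card_mono)
            then show ?thesis using Suc.prems(1)[OF h(1)] h(2) by auto
          qed
          moreover have "codegrees_le W (contract e H) (Suc p)
              (\<lambda>j. \<Sum>i<Suc p - j. (Suc p choose i) * \<delta> (i + j))"
            using codegrees_contract[OF fW eW(1) e(2) Suc.prems(1,2)] .
          moreover have "(\<Sum>j<Suc p. (j + 1) * ((k - p) choose j) * (\<Sum>i<Suc p - j. (Suc p choose i) * \<delta> (i + j)))
              < card W"
            using contracted_budget[of "k - p" "Suc p" \<delta>] Suc.prems(3) True
            by (simp del: sum.lessThan_Suc mult_Suc add_Suc_right)
          ultimately have "connected_upto V (k - p + 1) (avoiding W (contract e H))"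
            using False True by (intro contract_IH) auto
          moreover have "k + 1 - (card e - 1) = k - p + 1" using e True by simp
          ultimately show ?thesis by simp
        next
          case False
          then show ?thesis using e by (simp add: connected_upto_def)
        qed
        then have "connected_upto V (k + 1 - (card e - 1)) (link e (avoiding W (H - {e})))"
          using link_avoiding[OF e(1) eW] fin Suc.prems(1) e(2) by simp
        from connected_upto_missing_face[OF V(1) complex_on_avoiding[OF V(2)] _ eW(2) full this]
        show ?case using avoiding_remove[OF e(1), of W] eW(1) V(2) by simp
      qed
    qed
  qed
qed

text \<open>
  The budget of \<open>connected_upto_avoiding\<close> for the hypergraph of blockers of a set of \<open>f\<close> points, when \<open>k\<close>
  dimensions remain. The factor \<open>j + 1\<close> is at most \<open>d\<close>, the factor \<open>i\<close> is at most \<open>r = i + j\<close>, and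
  Vandermonde's identity collects the terms with the same \<open>r\<close>.
\<close>

lemma blocked_budget:
  fixes d k f :: nat
  shows "(\<Sum>j<d. (j + 1) * (k choose j) * (\<Sum>i<Suc (d - j). (f choose i) * i))
    \<le> d * (\<Sum>r=1..d. r * ((k + f) choose r))"
proof -
  have "(\<Sum>j<d. (j + 1) * (k choose j) * (\<Sum>i<Suc (d - j). (f choose i) * i))
      \<le> (\<Sum>j<d. \<Sum>i<Suc (d - j). d * (j + i) * ((k choose j) * (f choose i)))"
    unfolding sum_distrib_left
  proof (intro sum_mono)
    fix j i assume "j \<in> {..<d}"
    then have "(j + 1) * i \<le> d * (j + i)" by (intro mult_le_mono) auto
    then have "(k choose j) * (f choose i) * ((j + 1) * i) \<le> (k choose j) * (f choose i) * (d * (j + i))"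
      by (rule mult_left_mono) simp
    then show "(j + 1) * (k choose j) * ((f choose i) * i) \<le> d * (j + i) * ((k choose j) * (f choose i))"
      by (simp add: ac_simps del: mult_Suc mult_Suc_right)
  qed
  also have "\<dots> \<le> (\<Sum>j<Suc d. \<Sum>i<Suc d - j. d * (j + i) * ((k choose j) * (f choose i)))"
    by (simp add: Suc_diff_le)
  also have "\<dots> = (\<Sum>r<Suc d. \<Sum>j\<le>r. d * (j + (r - j)) * ((k choose j) * (f choose (r - j))))"
    by (rule sum_triangle)
  also have "\<dots> = (\<Sum>r<Suc d. d * (r * ((k + f) choose r)))"
  proof (rule sum.cong)
    fix r
    have "(\<Sum>j\<le>r. d * (j + (r - j)) * ((k choose j) * (f choose (r - j))))
        = (\<Sum>j\<le>r. d * r * ((k choose j) * (f choose (r - j))))" by (rule sum.cong) auto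
    then show "(\<Sum>j\<le>r. d * (j + (r - j)) * ((k choose j) * (f choose (r - j))))
        = d * (r * ((k + f) choose r))"
      by (simp only: sum_distrib_left[symmetric] vandermonde mult.assoc)
  qed simp
  also have "\<dots> = d * (\<Sum>r=1..d. r * ((k + f) choose r))"
    unfolding sum_distrib_left by (intro sum.mono_neutral_right) (auto simp: not_le)
  finally show ?thesis .
qed

section \<open>General position in loopless matroids\<close>

context matroid
begin

lemma finite_on_ground: "X \<subseteq> V \<Longrightarrow> finite X"
  by (rule finite_subset[OF _ finite_ground])

lemma general_position_ground: "general_position S \<Longrightarrow> S \<subseteq> V"
  by (simp add: general_position_def)

lemma indep_finite: "indep X \<Longrightarrow> finite X"
  by (rule finite_subset[OF indep_subset_ground finite_ground])

lemma finite_indep_cards: "finite {card X | X. X \<subseteq> S \<and> indep X}"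
  by (rule finite_subset[of _ "card ` Pow V"]) (use indep_subset_ground finite_ground in auto)

lemma card_le_rank: "X \<subseteq> S \<Longrightarrow> indep X \<Longrightarrow> card X \<le> rank S"
  unfolding rank_def using finite_indep_cards by (intro Max_ge) auto

lemma rank_attained:
  obtains X where "X \<subseteq> S" "indep X" "card X = rank S"
proof -
  have "rank S \<in> {card X | X. X \<subseteq> S \<and> indep X}"
    unfolding rank_def using finite_indep_cards indep_empty by (intro Max_in) auto
  then show ?thesis using that by auto
qed

lemma rank_mono: "S \<subseteq> T \<Longrightarrow> rank S \<le> rank T"
proof -
  assume "S \<subseteq> T"
  moreover obtain X where "X \<subseteq> S" "indep X" "card X = rank S" by (rule rank_attained)
  ultimately show "rank S \<le> rank T" using card_le_rank[of X T] by simp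
qed

lemma rank_indep: "indep X \<Longrightarrow> rank X = card X"
proof -
  assume X: "indep X"
  obtain Y where "Y \<subseteq> X" "indep Y" "card Y = rank X" by (rule rank_attained)
  then have "rank X \<le> card X" using card_mono[OF indep_finite[OF X], of Y] by simp
  then show "rank X = card X" using card_le_rank[of X X] X by simp
qed

lemma extend_indep:
  assumes "indep X" "indep Y" "card Y \<le> card X"
  shows "\<exists>Z. Y \<subseteq> Z \<and> Z \<subseteq> X \<union> Y \<and> indep Z \<and> card Z = card X"
  using assms
proof (induction "card X - card Y" arbitrary: Y)
  case 0
  then show ?case by (intro exI[of _ Y]) auto
next
  case (Suc n)
  then have "card Y < card X" by linarith
  then obtain x where x: "x \<in> X - Y" "indep (insert x Y)"
    using augment[OF Suc.prems(1,2)] by blast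
  have "card (insert x Y) = Suc (card Y)" using x indep_finite[OF Suc.prems(2)] by simp
  then have "n = card X - card (insert x Y)" "card (insert x Y) \<le> card X"
    using Suc.hyps(2) \<open>card Y < card X\<close> by simp_all
  from Suc.hyps(1)[OF this(1) Suc.prems(1) x(2) this(2)]
  obtain Z where "insert x Y \<subseteq> Z" "Z \<subseteq> X \<union> insert x Y" "indep Z" "card Z = card X" by blast
  then show ?case using x(1) by (intro exI[of _ Z]) auto
qed

lemma closure_of_indep:
  assumes X: "indep X"
  shows "X \<subseteq> cl X" "rank (cl X) = card X" "flat (cl X)"
proof -
  show sub: "X \<subseteq> cl X"
    using indep_subset_ground[OF X] by (auto simp: cl_def insert_absorb)
  have le: "card Y \<le> card X" if Y: "indep Y" "Y \<subseteq> cl X" for Y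
  proof (rule ccontr)
    assume "\<not> card Y \<le> card X"
    then obtain y where y: "y \<in> Y - X" "indep (insert y X)" using augment[OF Y(1) X] by auto
    then have "rank (X \<union> {y}) = Suc (card X)" using rank_indep[of "insert y X"] indep_finite[OF X] by simp
    moreover have "rank (X \<union> {y}) = card X" using y Y(2) rank_indep[OF X] by (auto simp: cl_def)
    ultimately show False by simp
  qed
  show rank: "rank (cl X) = card X"
  proof -
    obtain Y where "Y \<subseteq> cl X" "indep Y" "card Y = rank (cl X)" by (rule rank_attained)
    then have "rank (cl X) \<le> card X" using le[of Y] by simp
    then show ?thesis using card_le_rank[OF sub X] by simp
  qed
  have "v \<in> cl X \<longleftrightarrow> v \<in> cl (cl X)" for v
  proof
    assume v: "v \<in> cl X"
    then have "cl X \<union> {v} = cl X" "v \<in> V" by (auto simp: cl_def)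
    then show "v \<in> cl (cl X)" by (simp add: cl_def[of "cl X"])
  next
    assume "v \<in> cl (cl X)"
    then have v: "v \<in> V" "rank (cl X \<union> {v}) = card X" using rank by (auto simp: cl_def[of "cl X"])
    have "rank (X \<union> {v}) \<le> card X" using rank_mono[of "X \<union> {v}" "cl X \<union> {v}"] sub v by auto
    moreover have "card X \<le> rank (X \<union> {v})" using card_le_rank[OF _ X] by auto
    ultimately show "v \<in> cl X" using v(1) rank_indep[OF X] by (simp add: cl_def)
  qed
  moreover have "cl X \<subseteq> V" by (auto simp: cl_def)
  ultimately show "flat (cl X)" unfolding flat_def by blast
qed

text \<open>
  If \<open>T \<subseteq> S\<close> is a dependent set of minimal size, then \<open>T\<close> lies in the closure of the independent set
  \<open>T - {x}\<close>, which is a flat with too many points of \<open>S\<close>. Looplessness ensures that \<open>T - {x}\<close> is nonempty,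
  since flats of rank zero are unconstrained. Conversely, if a flat of rank \<open>k\<close> had more than \<open>k\<close> points in
  \<open>S\<close>, then \<open>k + 1\<close> of them would be independent.
\<close>

theorem general_position_iff:
  assumes loopless
  shows "general_position S \<longleftrightarrow> S \<subseteq> V \<and> (\<forall>T\<subseteq>S. card T \<le> rank V \<longrightarrow> indep T)"
proof (intro iffI conjI allI impI)
  assume S: "general_position S"
  then show SV: "S \<subseteq> V" by (simp add: general_position_def)
  fix T assume "T \<subseteq> S" "card T \<le> rank V"
  then show "indep T"
  proof (induction "card T" arbitrary: T rule: less_induct)
    case less
    have fT: "finite T" using less.prems SV by (intro finite_on_ground) blast
    show ?case
    proof (rule ccontr)
      assume dep: "\<not> indep T"
      then obtain x where x: "x \<in> T" using indep_empty by fastforce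
      let ?X = "T - {x}"
      have cX: "card T = Suc (card ?X)" using card_Suc_Diff1[OF fT x] by simp
      then have X: "indep ?X" using less.prems by (intro less.hyps) auto
      have "?X \<noteq> {}"
      proof
        assume "?X = {}"
        then have "T = {x}" using x by auto
        then show False using dep assms less.prems SV by (auto simp: loopless_def)
      qed
      then have "1 \<le> card ?X" using fT by (simp add: Suc_le_eq card_gt_0_iff)
      moreover have "card ?X < rank V" using cX less.prems by simp
      ultimately have "card (cl ?X \<inter> S) \<le> card ?X"
        using S closure_of_indep[OF X] unfolding general_position_def by blast
      moreover have "x \<in> cl ?X"
      proof -
        have "?X \<union> {x} = T" using x by auto
        moreover have "rank T \<le> card ?X"
        proof -
          obtain Y where Y: "Y \<subseteq> T" "indep Y" "card Y = rank T" by (rule rank_attained)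
          then have "Y \<subset> T" using dep by auto
          then have "card Y < card T" using fT psubset_card_mono by blast
          then show ?thesis using Y cX by simp
        qed
        moreover have "card ?X \<le> rank T" using card_le_rank[OF _ X] by blast
        ultimately show ?thesis
          using x less.prems SV rank_indep[OF X] by (auto simp: cl_def)
      qed
      then have "T \<subseteq> cl ?X \<inter> S" using closure_of_indep(1)[OF X] less.prems by auto
      then have "card T \<le> card (cl ?X \<inter> S)"
        using SV by (intro card_mono finite_on_ground) auto
      ultimately show False using cX by simp
    qed
  qed
next
  assume S: "S \<subseteq> V \<and> (\<forall>T\<subseteq>S. card T \<le> rank V \<longrightarrow> indep T)"
  show "general_position S"
    unfolding general_position_def
  proof (intro conjI allI impI)
    fix k F assume F: "1 \<le> k \<and> k < rank V \<and> flat F \<and> rank F = k"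
    show "card (F \<inter> S) \<le> k"
    proof (rule ccontr)
      assume "\<not> card (F \<inter> S) \<le> k"
      then have "Suc k \<le> card (F \<inter> S)" by simp
      then obtain T where T: "T \<subseteq> F \<inter> S" "card T = Suc k"
        by (rule obtain_subset_with_card_n)
      then have "T \<subseteq> S" "card T \<le> rank V" "T \<subseteq> F" using F by simp_all
      then have "indep T" using S by blast
      then show False using card_le_rank[OF \<open>T \<subseteq> F\<close>] T F by simp
    qed
  qed (use S in simp)
qed

lemma general_position_indep:
  "loopless \<Longrightarrow> general_position S \<Longrightarrow> T \<subseteq> S \<Longrightarrow> card T \<le> rank V \<Longrightarrow> indep T"
  using general_position_iff[of S] by blast

section \<open>Connectivity of the complex of sets in general position\<close>

text \<open>
  The complex on \<open>W\<close> that remains when the points of \<open>F\<close> have been replaced by their links.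
\<close>

definition extensions :: "'a set \<Rightarrow> 'a set \<Rightarrow> 'a set set" where
  "extensions F W = {\<sigma>. \<sigma> \<subseteq> W \<and> general_position (\<sigma> \<union> F)}"

lemma general_position_subset:
  "general_position S \<Longrightarrow> T \<subseteq> S \<Longrightarrow> general_position T"
proof -
  assume S: "general_position S" and T: "T \<subseteq> S"
  have le: "card (F \<inter> T) \<le> card (F \<inter> S)" for F
    using general_position_ground[OF S] T by (intro card_mono finite_on_ground) auto
  show "general_position T"
    unfolding general_position_def
  proof (intro conjI allI impI)
    show "T \<subseteq> V" using general_position_ground[OF S] T by blast
    fix k F assume "1 \<le> k \<and> k < rank V \<and> flat F \<and> rank F = k"
    then have "card (F \<inter> S) \<le> k" using S unfolding general_position_def by blast
    then show "card (F \<inter> T) \<le> k" using le[of F] by simp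
  qed
qed

lemma complex_on_extensions: "complex_on V (extensions F W)"
  unfolding complex_on_def
proof (intro conjI ballI allI impI)
  show "extensions F W \<subseteq> Pow V" by (auto simp: extensions_def general_position_def)
  fix \<sigma> \<tau> assume "\<sigma> \<in> extensions F W" "\<tau> \<subseteq> \<sigma>"
  then show "\<tau> \<in> extensions F W"
    using general_position_subset[of "\<sigma> \<union> F" "\<tau> \<union> F"] by (auto simp: extensions_def)
qed

lemma connected_upto_extensions_vertex:
  assumes "v \<in> V" "v \<in> W"
    and "connected_upto V k (extensions F (W - {v}))"
    and "connected_upto V (k - 1) (extensions (insert v F) (W - {v}))"
  shows "connected_upto V k (extensions F W)"
proof (rule connected_upto_vertex[OF finite_ground complex_on_extensions assms(1)])
  have "{\<sigma> \<in> extensions F W. v \<notin> \<sigma>} = extensions F (W - {v})"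
    by (auto simp: extensions_def)
  then show "connected_upto V k {\<sigma> \<in> extensions F W. v \<notin> \<sigma>}" using assms(3) by simp
  have "link {v} (extensions F W) = extensions (insert v F) (W - {v})"
    using assms(2) by (auto simp: extensions_def link_def)
  then show "connected_upto V (k - 1) (link {v} (extensions F W))" using assms(4) by simp
qed

text \<open>
  Points outside \<open>B\<close> are eliminated one at a time. After a deletion \<open>B\<close> still serves. When \<open>v\<close> is moved to
  \<open>F\<close>, the exchange property keeps all but one point of \<open>B\<close>, and one dimension has been paid. When only \<open>B\<close>
  is left, the complex is a simplex.
\<close>

lemma connected_upto_extensions_indep:
  assumes loopless
  shows "W \<subseteq> V \<Longrightarrow> B \<subseteq> W \<Longrightarrow> B \<inter> F = {} \<Longrightarrow> indep (B \<union> F) \<Longrightarrow>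
    connected_upto V (card B) (extensions F W)"
proof (induction "card W" arbitrary: W B F rule: less_induct)
  case less
  have fin: "finite W" "finite B" "finite F"
    using less.prems(1,2) indep_finite[OF less.prems(4)] by (auto intro: finite_on_ground)
  have rank: "card B + card F \<le> rank V"
    using card_le_rank[OF indep_subset_ground[OF less.prems(4)] less.prems(4)] less.prems(3) fin
    by (simp add: card_Un_disjoint)
  consider "B = {}" | "B = W" "B \<noteq> {}" | v where "v \<in> W - B" "B \<noteq> {}" using less.prems(2) by blast
  then show ?case
  proof cases
    case 1
    then show ?thesis by simp
  next
    case 2
    then obtain b where b: "b \<in> B" by blast
    have "extensions F W = Pow B"
    proof -
      have "general_position (\<sigma> \<union> F)" if "\<sigma> \<subseteq> B" for \<sigma>
      proof -
        have "indep T" if "T \<subseteq> \<sigma> \<union> F" for T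
          using indep_subset[OF less.prems(4)] that \<open>\<sigma> \<subseteq> B\<close> by blast
        then show ?thesis
          using general_position_iff[OF assms] indep_subset_ground[OF less.prems(4)] that by blast
      qed
      then show ?thesis using 2 by (auto simp: extensions_def)
    qed
    then show ?thesis
      using b less.prems(1,2)
      by (intro connected_upto_cone[of V b] finite_ground) (auto intro: finite_subset[OF _ fin(2)])
  next
    case 3
    have smaller: "card (W - {v}) < card W" using fin(1) 3 by (intro card_Diff1_less) auto
    have del: "connected_upto V (card B) (extensions F (W - {v}))"
      by (rule less.hyps[OF smaller]) (use 3 less.prems in auto)
    have lk: "connected_upto V (card B - 1) (extensions (insert v F) (W - {v}))"
    proof (cases "indep (insert v F)")
      case True
      have cB: "card B > 0" using 3 fin by (simp add: card_gt_0_iff)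
      have cF: "card (insert v F) \<le> Suc (card F)" using fin(3) by (simp add: card_insert_if)
      have cBF: "card (B \<union> F) = card B + card F" using fin less.prems(3) by (simp add: card_Un_disjoint)
      obtain Z where Z: "insert v F \<subseteq> Z" "Z \<subseteq> (B \<union> F) \<union> insert v F" "indep Z" "card Z = card B + card F"
      proof -
        have "card (insert v F) \<le> card (B \<union> F)" using cB cF cBF by linarith
        then show thesis using extend_indep[OF less.prems(4) True] cBF that by auto
      qed
      let ?B = "Z - insert v F"
      have "card Z = card ?B + card (insert v F)"
        using card_Diff_subset[of "insert v F" Z] Z(1) fin card_mono[OF indep_finite[OF Z(3)] Z(1)] by simp
      then have "card B - 1 \<le> card ?B" using Z(4) cF by simp
      then obtain B' where B': "B' \<subseteq> ?B" "card B' = card B - 1"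
        by (rule obtain_subset_with_card_n)
      have "connected_upto V (card B') (extensions (insert v F) (W - {v}))"
      proof (rule less.hyps[OF smaller])
        show "indep (B' \<union> insert v F)" using indep_subset[OF Z(3)] B'(1) Z(1) by blast
      qed (use B' Z less.prems 3 in auto)
      then show ?thesis using B'(2) by simp
    next
      case False
      have "\<not> general_position (\<sigma> \<union> insert v F)" for \<sigma>
      proof
        assume gp: "general_position (\<sigma> \<union> insert v F)"
        have "card (insert v F) \<le> rank V"
        proof -
          have "card B > 0" using 3 fin by (simp add: card_gt_0_iff)
          then show ?thesis using rank fin by (auto simp: card_insert_if)
        qed
        then show False using False general_position_indep[OF assms gp, of "insert v F"] by auto
      qed
      then have "extensions (insert v F) (W - {v}) = {}" by (auto simp: extensions_def)
      then show ?thesis by simp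
    qed
    have "v \<in> V" "v \<in> W" using 3 less.prems(1) by auto
    then show ?thesis using del lk by (rule connected_upto_extensions_vertex)
  qed
qed

definition circuit :: "'a set \<Rightarrow> bool" where
  "circuit C \<longleftrightarrow> C \<subseteq> V \<and> \<not> indep C \<and> (\<forall>x\<in>C. indep (C - {x}))"

lemma circuit_exists:
  assumes "T \<subseteq> V" "\<not> indep T"
  shows "\<exists>C\<subseteq>T. circuit C"
proof -
  have "finite T" by (rule finite_on_ground[OF assms(1)])
  then show ?thesis using assms
  proof (induction T rule: finite_psubset_induct)
    case (psubset T)
    show ?case
    proof (cases "circuit T")
      case False
      then obtain x where "x \<in> T" "\<not> indep (T - {x})" using psubset.prems by (auto simp: circuit_def)
      then show ?thesis using psubset.IH[of "T - {x}"] psubset.prems by blast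
    qed blast
  qed
qed

text \<open>
  The minimal nonfaces of \<open>extensions F S\<close> are among these traces on \<open>S\<close> of circuits meeting \<open>F\<close>.
\<close>

definition blockers :: "'a set \<Rightarrow> 'a set \<Rightarrow> 'a set set" where
  "blockers F S = {h. h \<subseteq> S \<and>
     (\<exists>F'\<subseteq>F. F' \<noteq> {} \<and> circuit (h \<union> F') \<and> card (h \<union> F') \<le> rank V)}"

text \<open>
  A set fails to be in general position exactly if it contains a circuit of at most \<open>rank V\<close> points. For
  \<open>\<sigma> \<union> F\<close> such a circuit must meet \<open>F\<close>, because \<open>S\<close> itself is in general position.
\<close>

lemma extensions_eq_avoiding:
  assumes loopless "general_position S" "F \<subseteq> V"
  shows "extensions F S = avoiding S (blockers F S)"
proof (intro set_eqI)
  fix \<sigma>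
  have "general_position (\<sigma> \<union> F) \<longleftrightarrow> (\<forall>h\<in>blockers F S. \<not> h \<subseteq> \<sigma>)" if \<sigma>: "\<sigma> \<subseteq> S"
  proof
    assume gp: "general_position (\<sigma> \<union> F)"
    have "\<not> h \<subseteq> \<sigma>" if "h \<in> blockers F S" for h
    proof
      assume "h \<subseteq> \<sigma>"
      moreover obtain F' where "F' \<subseteq> F" "circuit (h \<union> F')" "card (h \<union> F') \<le> rank V"
        using \<open>h \<in> blockers F S\<close> by (auto simp: blockers_def)
      ultimately have "h \<union> F' \<subseteq> \<sigma> \<union> F" "\<not> indep (h \<union> F')" "card (h \<union> F') \<le> rank V"
        by (auto simp: circuit_def)
      then show False using gp general_position_iff[OF assms(1), of "\<sigma> \<union> F"] by simp
    qed
    then show "\<forall>h\<in>blockers F S. \<not> h \<subseteq> \<sigma>" by blast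
  next
    assume free: "\<forall>h\<in>blockers F S. \<not> h \<subseteq> \<sigma>"
    have SV: "S \<subseteq> V" using assms(2) by (simp add: general_position_def)
    show "general_position (\<sigma> \<union> F)"
      unfolding general_position_iff[OF assms(1)]
    proof (intro conjI allI impI)
      show "\<sigma> \<union> F \<subseteq> V" using \<sigma> SV assms(3) by blast
      fix T assume T: "T \<subseteq> \<sigma> \<union> F" "card T \<le> rank V"
      show "indep T"
      proof (rule ccontr)
        assume dep: "\<not> indep T"
        have TV: "T \<subseteq> V" using T(1) \<sigma> SV assms(3) by blast
        then obtain C where C: "C \<subseteq> T" "circuit C" using circuit_exists dep by blast
        have cC: "card C \<le> rank V"
          using card_mono[OF finite_subset[OF TV finite_ground] C(1)] T(2) by simp
        have "\<not> C \<subseteq> S"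
          using general_position_indep[OF assms(1,2) _ cC] C(2) by (auto simp: circuit_def)
        then have "C - \<sigma> \<noteq> {}" "C - \<sigma> \<subseteq> F" using \<sigma> C(1) T(1) by auto
        moreover have "C \<inter> \<sigma> \<union> (C - \<sigma>) = C" by blast
        ultimately have "C \<inter> \<sigma> \<in> blockers F S"
          using C(2) cC \<sigma> unfolding blockers_def by (auto intro!: exI[of _ "C - \<sigma>"])
        then show False using free by blast
      qed
    qed
  qed
  then show "\<sigma> \<in> extensions F S \<longleftrightarrow> \<sigma> \<in> avoiding S (blockers F S)"
    by (auto simp: extensions_def avoiding_def)
qed

text \<open>
  All completing points lie in the span of the independent set \<open>D \<union> F\<close>. If there were more than \<open>card F\<close> of
  them, they would form together with \<open>D\<close> a subset of \<open>S\<close> with \<open>card D + card F + 1\<close> independent points, too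
  many for this span.
\<close>

lemma card_completions_le:
  assumes loopless "general_position S" "D \<subseteq> S" "F \<inter> S = {}" "finite F"
    and small: "card D + card F < rank V"
  shows "card {x \<in> S - D. circuit (insert x D \<union> F)} \<le> card F"
proof (rule ccontr)
  let ?X = "{x \<in> S - D. circuit (insert x D \<union> F)}"
  assume big: "\<not> card ?X \<le> card F"
  have fS: "finite S" by (rule finite_on_ground[OF general_position_ground[OF assms(2)]])
  have fD: "finite D" by (rule finite_subset[OF assms(3) fS])
  have "?X \<noteq> {}" using big card.empty by (metis le0)
  then obtain x where x: "x \<in> ?X" by blast
  have "insert x D \<union> F - {x} = D \<union> F" using x assms(3,4) by auto
  then have Y: "indep (D \<union> F)" using x unfolding circuit_def by fastforce
  have "card (D \<union> ?X) = card D + card ?X" using fS fD by (subst card_Un_disjoint) auto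
  then have "Suc (card D + card F) \<le> card (D \<union> ?X)" using big by simp
  then obtain T where T: "T \<subseteq> D \<union> ?X" "card T = Suc (card D + card F)"
    by (rule obtain_subset_with_card_n)
  have "T \<subseteq> S" using T(1) assms(3) by blast
  then have "indep T" using T(2) small by (intro general_position_indep[OF assms(1,2)]) auto
  moreover have "card (D \<union> F) < card T" using T(2) card_Un_le[of D F] by simp
  ultimately obtain y where y: "y \<in> T - (D \<union> F)" "indep (insert y (D \<union> F))"
    using augment[OF _ Y] by blast
  then have "circuit (insert y D \<union> F)" using T(1) by auto
  then show False using y(2) by (auto simp: circuit_def)
qed

text \<open>
  A circuit that meets \<open>F\<close> has at least one of its at most \<open>d + 1\<close> points outside \<open>S\<close>.
\<close>

lemma blockers_size:
  assumes "rank V = d + 1" "F \<inter> S = {}" "h \<in> blockers F S"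
  shows "h \<subseteq> S \<and> card h \<le> d"
proof -
  obtain F' where F': "F' \<subseteq> F" "F' \<noteq> {}" "circuit (h \<union> F')" "card (h \<union> F') \<le> d + 1" and h: "h \<subseteq> S"
    using assms(1,3) by (auto simp: blockers_def)
  have fin: "finite (h \<union> F')" using F'(3) by (intro finite_on_ground) (simp add: circuit_def)
  have "h \<subset> h \<union> F'" using F'(1,2) h assms(2) by blast
  then have "card h < card (h \<union> F')" using fin by (rule psubset_card_mono[rotated])
  then show ?thesis using F'(4) h by simp
qed

lemma codegrees_blockers:
  assumes loopless "general_position S" "F \<inter> S = {}" "F \<subseteq> V" "rank V = d + 1"
  shows "codegrees_le S (blockers F S) d (\<lambda>j. \<Sum>i<Suc (d - j). (card F choose i) * i)"
  unfolding codegrees_le_def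
proof (intro allI impI)
  fix D assume D: "D \<subseteq> S" "card D < d"
  have fS: "finite S" by (rule finite_on_ground[OF general_position_ground[OF assms(2)]])
  have fF: "finite F" by (rule finite_on_ground[OF assms(4)])
  let ?A = "{A. A \<subseteq> F \<and> card A < Suc (d - card D)}"
  let ?X = "\<lambda>A. {x \<in> S - D. circuit (insert x D \<union> A)}"
  have fA: "finite ?A" using fF by simp
  have "{x \<in> S - D. insert x D \<in> blockers F S} \<subseteq> (\<Union>A\<in>?A. ?X A)"
  proof
    fix x assume "x \<in> {x \<in> S - D. insert x D \<in> blockers F S}"
    then obtain A where x: "x \<in> S" "x \<notin> D" and A: "A \<subseteq> F" "circuit (insert x D \<union> A)"
      "card (insert x D \<union> A) \<le> d + 1"
      using assms(5) by (auto simp: blockers_def)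
    have "card (insert x D \<union> A) = card (insert x D) + card A"
      using x D(1) A(1) assms(3) finite_subset[OF D(1) fS] finite_subset[OF A(1) fF]
      by (intro card_Un_disjoint) auto
    then have "Suc (card D) + card A \<le> d + 1"
      using A(3) x(2) finite_subset[OF D(1) fS] by simp
    then have "A \<in> ?A" using A(1) D(2) by auto
    then show "x \<in> (\<Union>A\<in>?A. ?X A)" using x A(2) by blast
  qed
  then have "card {x \<in> S - D. insert x D \<in> blockers F S} \<le> card (\<Union>A\<in>?A. ?X A)"
    by (intro card_mono[OF finite_subset[OF _ fS]]) auto
  also have "\<dots> \<le> (\<Sum>A\<in>?A. card (?X A))" using fA by (rule card_UN_le)
  also have "\<dots> \<le> (\<Sum>A\<in>?A. card A)"
  proof (rule sum_mono)
    fix A assume A: "A \<in> ?A"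
    then have "card D + card A < rank V" using D(2) assms(5) by auto
    moreover have "A \<inter> S = {}" "finite A" using A assms(3) finite_subset[OF _ fF] by auto
    ultimately show "card (?X A) \<le> card A"
      using card_completions_le[OF assms(1,2) D(1)] by blast
  qed
  also have "\<dots> = (\<Sum>i<Suc (d - card D). (card F choose i) * i)"
    using sum_small_subsets[OF fF, of "\<lambda>i. i" "Suc (d - card D)"] by simp
  finally show "card {x \<in> S - D. insert x D \<in> blockers F S}
      \<le> (\<Sum>i<Suc (d - card D). (card F choose i) * i)" .
qed

lemma connected_upto_extensions_general_position:
  assumes loopless "general_position S" "F \<inter> S = {}" "F \<subseteq> V" "rank V = d + 1"
    and big: "d * (\<Sum>r=1..d. r * (n choose r)) < card S"
  shows "connected_upto V (n + 1 - card F) (extensions F S)"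
proof (cases "card F \<le> n")
  case True
  have SV: "S \<subseteq> V" using assms(2) by (simp add: general_position_def)
  have "(\<Sum>j<d. (j + 1) * ((n - card F) choose j) * (\<Sum>i<Suc (d - j). (card F choose i) * i)) < card S"
    using blocked_budget[of "n - card F" "card F" d] big True by (simp del: sum.lessThan_Suc)
  then have "connected_upto V (n - card F + 1) (avoiding S (blockers F S))"
    by (intro connected_upto_avoiding[OF finite_ground SV blockers_size[OF assms(5,3)]
          codegrees_blockers[OF assms(1-5)]])
  then show ?thesis
    using True by (simp add: extensions_eq_avoiding[OF assms(1,2,4)] Suc_diff_le)
qed simp

text \<open>
  The points \<open>Q\<close> outside \<open>S\<close> are eliminated by the vertex rule. Each of them is either deleted or moved to
  \<open>F\<close>, and the latter lowers the required connectivity by one.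
\<close>

lemma connected_upto_extensions_large:
  assumes loopless "general_position S" "rank V = d + 1"
    and big: "d * (\<Sum>r=1..d. r * (n choose r)) < card S"
    and "finite Q"
  shows "Q \<subseteq> V \<Longrightarrow> F \<subseteq> V \<Longrightarrow> F \<inter> (S \<union> Q) = {} \<Longrightarrow> Q \<inter> S = {} \<Longrightarrow>
    connected_upto V (n + 1 - card F) (extensions F (S \<union> Q))"
  using \<open>finite Q\<close>
proof (induction Q arbitrary: F)
  case empty
  then show ?case using connected_upto_extensions_general_position[OF assms(1,2) _ _ assms(3) big] by simp
next
  case (insert v Q)
  have fF: "finite F" by (rule finite_on_ground[OF insert.prems(2)])
  have eq: "S \<union> insert v Q - {v} = S \<union> Q" using insert by auto
  have "v \<in> V" "v \<in> S \<union> insert v Q" using insert.prems by auto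
  moreover have "connected_upto V (n + 1 - card F) (extensions F (S \<union> insert v Q - {v}))"
    unfolding eq using insert.prems by (intro insert.IH) auto
  moreover have "connected_upto V (n + 1 - card F - 1) (extensions (insert v F) (S \<union> insert v Q - {v}))"
  proof -
    have "card (insert v F) = card F + 1" using insert.prems fF by auto
    moreover have "connected_upto V (n + 1 - card (insert v F)) (extensions (insert v F) (S \<union> Q))"
      using insert.prems insert.hyps by (intro insert.IH) auto
    ultimately show ?thesis unfolding eq by simp
  qed
  ultimately show ?case by (rule connected_upto_extensions_vertex)
qed

lemma phi_attained:
  obtains X where "X \<subseteq> S" "general_position X" "card X = phi S"
proof -
  have "finite {card X | X. X \<subseteq> S \<and> general_position X}"
    by (rule finite_subset[of _ "card ` Pow V"])
      (use finite_ground in \<open>auto simp: general_position_def\<close>)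
  moreover have "general_position {}" by (simp add: general_position_def)
  ultimately have "phi S \<in> {card X | X. X \<subseteq> S \<and> general_position X}"
    unfolding phi_def by (intro Max_in) auto
  then show ?thesis using that by auto
qed

lemma connected_upto_of_phi:
  assumes loopless "rank V = d + 1" "U \<subseteq> V" "0 < k"
    and phi: "(if k \<le> d + 1 then k - 1 else d * (\<Sum>r=1..d. r * ((k - 1) choose r))) < phi U"
  shows "connected_upto V k (extensions {} U)"
proof -
  obtain S where S: "S \<subseteq> U" "general_position S" "card S = phi U" by (rule phi_attained)
  show ?thesis
  proof (cases "k \<le> d + 1")
    case True
    then have "k \<le> card S" using phi S(3) by auto
    then obtain B where B: "B \<subseteq> S" "card B = k" by (rule obtain_subset_with_card_n)
    then have "indep B" using True assms(2) by (intro general_position_indep[OF assms(1) S(2)]) auto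
    then show ?thesis
      using connected_upto_extensions_indep[OF assms(1,3), of B "{}"] B S(1) by auto
  next
    case False
    then have "d * (\<Sum>r=1..d. r * ((k - 1) choose r)) < card S" using phi S(3) by auto
    moreover have "finite (U - S)" using assms(3) by (intro finite_on_ground) blast
    ultimately have "connected_upto V (k - 1 + 1 - card ({} :: 'a set)) (extensions {} (S \<union> (U - S)))"
      using assms(3) by (intro connected_upto_extensions_large[OF assms(1) S(2) assms(2)]) auto
    moreover have "S \<union> (U - S) = U" using S(1) by blast
    ultimately show ?thesis using \<open>0 < k\<close> by simp
  qed
qed

end

section \<open>Colourful sets in general position\<close>

theorem theorem1p10:
  fixes V :: "'a set" and indep :: "'a set \<Rightarrow> bool"
    and P :: "nat \<Rightarrow> 'a set" and d m :: nat
  assumes "matroid V indep"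
    and "matroid.loopless V indep"
    and "matroid.rank indep V = d + 1"
    and "disjoint_family_on P {1..m}"
    and "(\<Union>i\<in>{1..m}. P i) = V"
    and "\<And>I. I \<noteq> {} \<Longrightarrow> I \<subseteq> {1..m} \<Longrightarrow>
           matroid.phi V indep (\<Union>i\<in>I. P i) >
             (if card I \<le> d + 1 then card I - 1
              else d * (\<Sum>r=1..d. r * ((card I - 1) choose r)))"
  shows "\<exists>\<sigma>. \<sigma> \<subseteq> V \<and> matroid.general_position V indep \<sigma> \<and>
           (\<forall>i\<in>{1..m}. card (\<sigma> \<inter> P i) = 1)"
proof -
  interpret matroid V indep by (rule assms(1))
  have "\<forall>v. \<exists>i. v \<in> V \<longrightarrow> i \<in> {1..m} \<and> v \<in> P i" using assms(5) by blast
  from choice[OF this] obtain col where col: "v \<in> V \<Longrightarrow> col v \<in> {1..m} \<and> v \<in> P (col v)" for v by auto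
  have mem: "v \<in> P i \<longleftrightarrow> col v = i" if "v \<in> V" "i \<in> {1..m}" for v i
  proof
    assume "v \<in> P i"
    then show "col v = i"
      using col[OF that(1)] that(2) disjoint_family_onD[OF assms(4), of i "col v"] by blast
  next
    assume "col v = i"
    then show "v \<in> P i" using col[OF that(1)] by simp
  qed
  let ?K = "Collect general_position"
  have "\<exists>\<sigma>\<in>?K. card \<sigma> = card {1..m} \<and> col ` \<sigma> = {1..m}"
  proof (rule rainbow_simplex[OF finite_ground])
    show "complex_on V ?K"
    proof -
      have "extensions {} V = ?K" by (auto simp: extensions_def dest: general_position_ground)
      then show ?thesis using complex_on_extensions[of "{}" V] by simp
    qed
    show "{} \<in> ?K" by (simp add: general_position_def)
    fix I assume I: "I \<subseteq> {1..m}" "I \<noteq> {}"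
    let ?U = "\<Union>i\<in>I. P i"
    have "?U \<subseteq> V" using I(1) assms(5) by blast
    have "\<sigma> \<subseteq> ?U \<longleftrightarrow> col ` \<sigma> \<subseteq> I" if "general_position \<sigma>" for \<sigma>
    proof -
      have "v \<in> ?U \<longleftrightarrow> col v \<in> I" if "v \<in> \<sigma>" for v
      proof -
        have "v \<in> V" using that \<open>general_position \<sigma>\<close> by (auto simp: general_position_def)
        then show ?thesis using mem I(1) by blast
      qed
      then show ?thesis by blast
    qed
    then have "{\<sigma> \<in> ?K. col ` \<sigma> \<subseteq> I} = extensions {} ?U" by (auto simp: extensions_def)
    moreover have "0 < card I" using I finite_subset[OF I(1)] by (simp add: card_gt_0_iff)
    ultimately show "connected_upto V (card I) {\<sigma> \<in> ?K. col ` \<sigma> \<subseteq> I}"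
      using connected_upto_of_phi[OF assms(2,3) \<open>?U \<subseteq> V\<close> _ assms(6)[OF I(2,1)]] by simp
  qed simp
  then obtain \<sigma> where \<sigma>: "general_position \<sigma>" "card \<sigma> = card {1..m}" "col ` \<sigma> = {1..m}" by blast
  have "\<sigma> \<subseteq> V" using \<sigma>(1) by (simp add: general_position_def)
  have inj: "inj_on col \<sigma>"
    using \<sigma>(2,3) finite_subset[OF \<open>\<sigma> \<subseteq> V\<close> finite_ground] by (intro eq_card_imp_inj_on) auto
  have "card (\<sigma> \<inter> P i) = 1" if i: "i \<in> {1..m}" for i
  proof -
    have "i \<in> col ` \<sigma>" using \<sigma>(3) i by simp
    then obtain v where v: "v \<in> \<sigma>" "col v = i" by blast
    have "w \<in> \<sigma> \<inter> P i \<longleftrightarrow> w = v" for w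
      using v mem[OF _ i] \<open>\<sigma> \<subseteq> V\<close> inj by (auto simp: inj_on_def)
    then have "\<sigma> \<inter> P i = {v}" by blast
    then show ?thesis by simp
  qed
  then show ?thesis using \<open>\<sigma> \<subseteq> V\<close> \<sigma>(1) by blast
qed

end
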